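(* Let $A$ be a left-symmetric conformal algebra, let $g(A)$ be its sub-adjacent Lie conformal algebra, and let $M$ be an $A$-module. Then the cohomology spaces $H^{n-1}_{Lie}\big(g(A),\mathrm{CHom}(A,M)\big)$ and $H^n(A,M)$ are isomorphic.
   Context: All $\mathbb{C}[\partial]$-modules are assumed finitely generated. Products and actions are extended coefficientwise to polynomials in the variables $\lambda_i$; $b_{-\partial-\lambda}a$ means: write $b_\mu a=\sum_k\mu^k x_k$ and take $\sum_k(-\partial-\lambda)^k x_k$ (similarly for other substitutions involving $\partial$, where $\partial$ acts on the value). A hat means omission. A left-symmetric conformal algebra is a $\mathbb{C}[\partial]$-module $A$ with a $\mathbb{C}$-linear map $A\otimes A\to A[\lambda]$, $a\otimes b\mapsto a_\lambda b$, such that $(\partial a)_\lambda b=-\lambda a_\lambda b$, $a_\lambda(\partial b)=(\partial+\lambda)a_\lambda b$ and $(a_\lambda b)_{\lambda+\mu}c-a_\lambda(b_\mu c)=(b_\mu a)_{\lambda+\mu}c-b_\mu(a_\lambda c)$. A Lie conformal algebra is a $\mathbb{C}[\partial]$-module $R$ with a $\mathbb{C}$-linear map $R\otimes R\to R[\lambda]$, $a\otimes b\mapsto[a_\lambda b]$, such that $[(\partial a)_\lambda b]=-\lambda[a_\lambda b]$, $[a_\lambda \partial b]=(\partial+\lambda)[a_\lambda b]$, $[a_\lambda b]=-[b_{-\partial-\lambda}a]$ and $[a_\lambda[b_\mu c]]=[[a_\lambda b]_{\lambda+\mu}c]+[b_\mu[a_\lambda c]]$. The sub-adjacent Lie conformal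 algebra $g(A)$ is $A$ with $[a_\lambda b]=a_\lambda b-b_{-\partial-\lambda}a$. A module over a Lie conformal algebra $R$ is a $\mathbb{C}[\partial]$-module $V$ with a $\mathbb{C}$-linear map $R\otimes V\to V[\lambda]$, $a\otimes v\mapsto a_\lambda v$, such that $(\partial a)_\lambda v=-\lambda a_\lambda v$, $a_\lambda(\partial v)=(\partial+\lambda)a_\lambda v$ and $a_\lambda(b_\mu v)-b_\mu(a_\lambda v)=[a_\lambda b]_{\lambda+\mu}v$. An $A$-module (for $A$ left-symmetric conformal) is a $\mathbb{C}[\partial]$-module $M$ with $\mathbb{C}$-linear maps $a\otimes v\mapsto a_\lambda v\in M[\lambda]$ and $v\otimes a\mapsto v_\lambda a\in M[\lambda]$ such that $(\partial a)_\lambda v=-\lambda a_\lambda v$, $a_\lambda(\partial v)=(\partial+\lambda)a_\lambda v$, $(\partial v)_\lambda a=-\lambda v_\lambda a$, $v_\lambda(\partial a)=(\partial+\lambda)v_\lambda a$, $(a_\lambda b)_{\lambda+\mu}v-a_\lambda(b_\mu v)=(b_\mu a)_{\lambda+\mu}v-b_\mu(a_\lambda v)$ and $(a_\lambda v)_{\lambda+\mu}b-a_\lambda(v_\mu b)=(v_\mu a)_{\lambda+\mu}b-v_\mu(a_\lambda b)$. $\mathrm{CHom}(A,M)$ is the set of conformal linear maps, i.e. $\mathbb{C}$-linear $f_\lambda:A\to M[\lambda]$ with $f_\lambda(\partial a)=(\partial+\lambda)f_\lambda(a)$; it is a $\mathbb{C}[\partial]$-module via $(\partial f)_\lambda=-\lambda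 f_\lambda$, and a $g(A)$-module via $(a_\lambda f)_{\lambda+\mu}(b)=a_\lambda(f_\mu(b))+f_\mu(a)_{\lambda+\mu}b-f_\mu(a_\lambda b)$. Cochains. For $\mathbb{C}[\partial]$-modules $R,V$ and $m\ge1$, let $\mathrm{CHom}(R^{\otimes (m-1)}\otimes R,V)$ be the set of $\mathbb{C}$-linear maps $\gamma_{\lambda_1,\dots,\lambda_{m-1}}:R^{\otimes m}\to V[\lambda_1,\dots,\lambda_{m-1}]$ such that $\gamma_{\lambda_1,\dots,\lambda_{m-1}}(a_1,\dots,\partial a_i,\dots,a_m)=-\lambda_i\gamma_{\lambda_1,\dots,\lambda_{m-1}}(a_1,\dots,a_m)$ for $i\le m-1$, $\gamma_{\lambda_1,\dots,\lambda_{m-1}}(a_1,\dots,\partial a_m)=(\partial+\lambda_1+\cdots+\lambda_{m-1})\gamma_{\lambda_1,\dots,\lambda_{m-1}}(a_1,\dots,a_m)$, and $\gamma$ changes sign under simultaneous interchange of $a_i,a_j$ and $\lambda_i,\lambda_j$ for $1\le i<j\le m-1$. Let $C^m(A,M)=\mathrm{CHom}(A^{\otimes(m-1)}\otimes A,M)$, $m\ge1$. For a Lie conformal algebra $R$ and an $R$-module $V$, $C^m_{Lie}(R,V)$, $m\ge1$, is the subset of $\mathrm{CHom}(R^{\otimes (m-1)}\otimes R,V)$ of those $\gamma$ which moreover satisfy, for $1\le i\le m-1$, $\gamma_{\lambda_1,\dots,\lambda_{m-1}}(a_1,\dots,a_i,\dots,a_m)=-\gamma_{\lambda_1,\dots,\lambda_{i-1},-\partial-\lambda_1-\cdots-\lambda_{m-1},\lambda_{i+1},\dots,\lambda_{m-1}}(a_1,\dots,a_m,\dots,a_i)$.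 Operator $d:C^m_{Lie}(R,V)\to C^{m+1}_{Lie}(R,V)$: $$(d\gamma)_{\lambda_1,\dots,\lambda_m}(a_1,\dots,a_{m+1})=\sum_{i=1}^m(-1)^{i+1}{a_i}_{\lambda_i}\gamma_{\lambda_1,\dots,\hat\lambda_i,\dots,\lambda_m}(a_1,\dots,\hat a_i,\dots,a_{m+1})+(-1)^m (a_{m+1})_{-\partial-\lambda_1-\cdots-\lambda_m}\gamma_{\lambda_1,\dots,\lambda_{m-1}}(a_1,\dots,a_m)$$ $$+\sum_{1\le i<j\le m}(-1)^{i+j}\gamma_{\lambda_i+\lambda_j,\lambda_1,\dots,\hat\lambda_{i,j},\dots,\lambda_m}([{a_i}_{\lambda_i}a_j],a_1,\dots,\hat a_{i,j},\dots,a_{m+1})+\sum_{i=1}^m(-1)^{i+m+1}\gamma_{\nu_i,\dots}([{a_i}_{\lambda_i}a_{m+1}],a_1,\dots,\hat a_i,\dots,a_m),$$ where in the last sum the subscript of the first argument is $\nu_i=-\partial-\sum_{k\ne i}\lambda_k$, each other argument $a_k$ has subscript $\lambda_k$, and the subscript of the last listed argument is omitted. One has $d^2=0$, and $H^*_{Lie}(R,V)$ denotes the cohomology (cocycles modulo coboundaries) of the complex $(C^*_{Lie}(R,V),d)$. Operator $\delta:C^m(A,M)\to C^{m+1}(A,M)$: $$(\delta\gamma)_{\lambda_1,\dots,\lambda_m}(a_1,\dots,a_{m+1})=\sum_{i=1}^m(-1)^{i+1}{a_i}_{\lambda_i}\gamma_{\lambda_1,\dots,\hat\lambda_i,\dots,\lambda_m}(a_1,\dots,\hat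 a_i,\dots,a_{m+1})$$ $$+\sum_{i=1}^m(-1)^{i+1}\gamma_{\lambda_1,\dots,\hat\lambda_i,\dots,\lambda_m}(a_1,\dots,\hat a_i,\dots,a_m,a_i)_{\lambda_1+\cdots+\lambda_m}a_{m+1}-\sum_{i=1}^m(-1)^{i+1}\gamma_{\lambda_1,\dots,\hat\lambda_i,\dots,\lambda_m}(a_1,\dots,\hat a_i,\dots,a_m,{a_i}_{\lambda_i}a_{m+1})$$ $$+\sum_{1\le i<j\le m}(-1)^{i+j}\gamma_{\lambda_i+\lambda_j,\lambda_1,\dots,\hat\lambda_{i,j},\dots,\lambda_m}([{a_i}_{\lambda_i}a_j],a_1,\dots,\hat a_{i,j},\dots,a_{m+1}).$$ One has $\delta^2=0$, and $H^*(A,M)$ denotes the cohomology (cocycles modulo coboundaries) of the complex $(C^*(A,M),\delta)$.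
   Formalization: Proved for n ≥ 3: for n ≤ 1 the Lie cohomology degree n−1 is undefined, and for n = 2 the claim fails in general, since the Lie complex starts in degree 1 and H^1_Lie has no coboundaries while H^2(A,M) is still divided by δC^1(A,M). *)

theory Defs
  imports Complex_Main "HOL-Computational_Algebra.Polynomial"
    "HOL-Library.Poly_Mapping" "HOL-Library.Function_Algebras" "HOL-Library.Set_Algebras"
begin

text \<open>
  A \<open>\<complex>[\<partial>]\<close>-module is a scaling \<open>s :: complex poly \<Rightarrow> 'v \<Rightarrow> 'v\<close> satisfying the locale
  \<^locale>\<open>module\<close>: the polynomial variable acts as \<open>\<partial>\<close>, constant polynomials as the scalars.
\<close>

abbreviation D :: "complex poly" where
  "D \<equiv> [:0, 1:]"

definition finitely_generated :: "(complex poly \<Rightarrow> 'v::ab_group_add \<Rightarrow> 'v) \<Rightarrow> bool" where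
  "finitely_generated s \<longleftrightarrow> (\<exists>F. finite F \<and> module.span s F = UNIV)"


section \<open>Polynomials with coefficients in a module\<close>

text \<open>
  \<open>'v lpoly\<close> is \<open>V[\<lambda>\<^sub>0, \<lambda>\<^sub>1, \<dots>]\<close>: a finitely supported family of coefficients, indexed by exponent
  vectors. The ring \<open>\<complex>[\<partial>][\<lambda>\<^sub>0, \<lambda>\<^sub>1, \<dots>]\<close> of \<open>scalars\<close>, with the library's ring structure on
  \<open>\<Rightarrow>\<^sub>0\<close>, acts on it. Variables and arguments are numbered from \<open>0\<close>.
\<close>

type_synonym 'v lpoly = "(nat \<Rightarrow>\<^sub>0 nat) \<Rightarrow>\<^sub>0 'v"
type_synonym scalars = "(complex poly) lpoly"

definition const :: "'v \<Rightarrow> 'v::zero lpoly" where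
  "const v = Poly_Mapping.single 0 v"

definition lam :: "nat \<Rightarrow> scalars" where
  "lam i = Poly_Mapping.single (Poly_Mapping.single i 1) 1"

definition del :: scalars where
  "del = const D"

definition lpolys :: "'v::zero set \<Rightarrow> nat \<Rightarrow> 'v lpoly set" where
  "lpolys V n = {P. \<forall>\<alpha>\<in>Poly_Mapping.keys P.
     Poly_Mapping.keys \<alpha> \<subseteq> {..<n} \<and> Poly_Mapping.lookup P \<alpha> \<in> V}"

definition lact ::
    "(complex poly \<Rightarrow> 'v::ab_group_add \<Rightarrow> 'v) \<Rightarrow> scalars \<Rightarrow> 'v lpoly \<Rightarrow> 'v lpoly" where
  "lact s q P = (\<Sum>\<alpha>\<in>Poly_Mapping.keys q. \<Sum>\<beta>\<in>Poly_Mapping.keys P.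
     Poly_Mapping.single (\<alpha> + \<beta>) (s (Poly_Mapping.lookup q \<alpha>) (Poly_Mapping.lookup P \<beta>)))"

text \<open>
  \<open>lsubst s qs P\<close> replaces each \<open>\<lambda>\<^sub>i\<close> in \<open>P\<close> by \<open>qs ! i\<close>. If \<open>qs ! i\<close> involves \<open>\<partial>\<close>, then \<open>\<partial>\<close> acts on
  the coefficients of \<open>P\<close>.
\<close>

definition lsubst ::
    "(complex poly \<Rightarrow> 'v::ab_group_add \<Rightarrow> 'v) \<Rightarrow> scalars list \<Rightarrow> 'v lpoly \<Rightarrow> 'v lpoly" where
  "lsubst s qs P = (\<Sum>\<alpha>\<in>Poly_Mapping.keys P.
     lact s (\<Prod>i\<in>Poly_Mapping.keys \<alpha>. (qs ! i) ^ Poly_Mapping.lookup \<alpha> i)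
       (const (Poly_Mapping.lookup P \<alpha>)))"

text \<open>
  A \<open>\<lambda>\<close>-product is given by \<open>op a b \<in> W[\<lambda>\<^sub>0]\<close>. \<open>bil s op P q Q\<close> is its coefficientwise extension
  \<open>P\<^sub>q Q\<close> to polynomials \<open>P\<close>, \<open>Q\<close>, with subscript \<open>q\<close>; \<open>s\<close> is the scaling of the target \<open>W\<close>.
\<close>

definition bil ::
    "(complex poly \<Rightarrow> 'w::ab_group_add \<Rightarrow> 'w) \<Rightarrow> ('u::zero \<Rightarrow> 'v::zero \<Rightarrow> 'w lpoly) \<Rightarrow>
     'u lpoly \<Rightarrow> scalars \<Rightarrow> 'v lpoly \<Rightarrow> 'w lpoly" where
  "bil s op P q Q = (\<Sum>\<alpha>\<in>Poly_Mapping.keys P. \<Sum>\<beta>\<in>Poly_Mapping.keys Q.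
     lact s (Poly_Mapping.single (\<alpha> + \<beta>) 1)
       (lsubst s [q] (op (Poly_Mapping.lookup P \<alpha>) (Poly_Mapping.lookup Q \<beta>))))"

text \<open>Likewise \<open>capp s \<gamma> qs Ps\<close> is \<open>\<gamma>\<close> with subscripts \<open>qs\<close> and polynomial arguments \<open>Ps\<close>.\<close>

definition capp ::
    "(complex poly \<Rightarrow> 'v::ab_group_add \<Rightarrow> 'v) \<Rightarrow> ('u::zero list \<Rightarrow> 'v lpoly) \<Rightarrow>
     scalars list \<Rightarrow> 'u lpoly list \<Rightarrow> 'v lpoly" where
  "capp s \<gamma> qs Ps = (\<Sum>\<alpha>s\<in>listset (map Poly_Mapping.keys Ps).
     lact s (Poly_Mapping.single (sum_list \<alpha>s) 1)
       (lsubst s qs (\<gamma> (map2 Poly_Mapping.lookup Ps \<alpha>s))))"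

definition C_linear ::
    "(complex poly \<Rightarrow> 'v::ab_group_add \<Rightarrow> 'v) \<Rightarrow> (complex poly \<Rightarrow> 'w::ab_group_add \<Rightarrow> 'w) \<Rightarrow>
     ('v \<Rightarrow> 'w lpoly) \<Rightarrow> bool" where
  "C_linear s t f \<longleftrightarrow> (\<forall>x y. f (x + y) = f x + f y) \<and>
     (\<forall>c x. f (s [:c:] x) = lact t (const [:c:]) (f x))"


section \<open>Left-symmetric conformal algebras and their modules\<close>

text \<open>\<open>\<complex>\<close>-bilinear \<open>U \<otimes> V \<rightarrow> W[\<lambda>]\<close> with \<open>(\<partial>u)\<^sub>\<lambda> v = -\<lambda> u\<^sub>\<lambda> v\<close> and \<open>u\<^sub>\<lambda> (\<partial>v) = (\<partial> + \<lambda>) u\<^sub>\<lambda> v\<close>.\<close>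

definition conformal_product ::
    "(complex poly \<Rightarrow> 'u::ab_group_add \<Rightarrow> 'u) \<Rightarrow> (complex poly \<Rightarrow> 'v::ab_group_add \<Rightarrow> 'v) \<Rightarrow>
     (complex poly \<Rightarrow> 'w::ab_group_add \<Rightarrow> 'w) \<Rightarrow> ('u \<Rightarrow> 'v \<Rightarrow> 'w lpoly) \<Rightarrow> bool" where
  "conformal_product sU sV sW op \<longleftrightarrow>
     (\<forall>u v. op u v \<in> lpolys UNIV 1) \<and>
     (\<forall>v. C_linear sU sW (\<lambda>u. op u v)) \<and>
     (\<forall>u. C_linear sV sW (\<lambda>v. op u v)) \<and>
     (\<forall>u v. op (sU D u) v = lact sW (- lam 0) (op u v)) \<and>
     (\<forall>u v. op u (sV D v) = lact sW (del + lam 0) (op u v))"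

text \<open>In the identities below, \<open>\<lambda>\<close> and \<open>\<mu>\<close> are the variables \<open>lam 0\<close> and \<open>lam 1\<close>.\<close>

locale left_symmetric_conformal_algebra = module sA
  for sA :: "complex poly \<Rightarrow> 'a::ab_group_add \<Rightarrow> 'a" +
  fixes prd :: "'a \<Rightarrow> 'a \<Rightarrow> 'a lpoly"
  assumes fg: "finitely_generated sA"
    and product: "conformal_product sA sA sA prd"
    and left_symmetric:
      "bil sA prd (bil sA prd (const a) (lam 0) (const b)) (lam 0 + lam 1) (const c)
         - bil sA prd (const a) (lam 0) (bil sA prd (const b) (lam 1) (const c))
       = bil sA prd (bil sA prd (const b) (lam 1) (const a)) (lam 0 + lam 1) (const c)
         - bil sA prd (const b) (lam 1) (bil sA prd (const a) (lam 0) (const c))"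

locale lsca_module = A: left_symmetric_conformal_algebra sA prd + M: module sM
  for sA :: "complex poly \<Rightarrow> 'a::ab_group_add \<Rightarrow> 'a"
    and prd :: "'a \<Rightarrow> 'a \<Rightarrow> 'a lpoly"
    and sM :: "complex poly \<Rightarrow> 'm::ab_group_add \<Rightarrow> 'm" +
  fixes lM :: "'a \<Rightarrow> 'm \<Rightarrow> 'm lpoly"
    and rM :: "'m \<Rightarrow> 'a \<Rightarrow> 'm lpoly"
  assumes fg_M: "finitely_generated sM"
    and left_product: "conformal_product sA sM sM lM"
    and right_product: "conformal_product sM sA sM rM"
    and left_module:
      "bil sM lM (bil sA prd (const a) (lam 0) (const b)) (lam 0 + lam 1) (const v)
         - bil sM lM (const a) (lam 0) (bil sM lM (const b) (lam 1) (const v))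
       = bil sM lM (bil sA prd (const b) (lam 1) (const a)) (lam 0 + lam 1) (const v)
         - bil sM lM (const b) (lam 1) (bil sM lM (const a) (lam 0) (const v))"
    and bimodule:
      "bil sM rM (bil sM lM (const a) (lam 0) (const v)) (lam 0 + lam 1) (const b)
         - bil sM lM (const a) (lam 0) (bil sM rM (const v) (lam 1) (const b))
       = bil sM rM (bil sM rM (const v) (lam 1) (const a)) (lam 0 + lam 1) (const b)
         - bil sM rM (const v) (lam 1) (bil sA prd (const a) (lam 0) (const b))"

text \<open>The bracket of the sub-adjacent Lie conformal algebra: \<open>[a\<^sub>\<lambda> b] = a\<^sub>\<lambda> b - b\<^bsub>-\<partial>-\<lambda>\<^esub> a\<close>.\<close>

definition subadjacent ::
    "(complex poly \<Rightarrow> 'a::ab_group_add \<Rightarrow> 'a) \<Rightarrow> ('a \<Rightarrow> 'a \<Rightarrow> 'a lpoly) \<Rightarrow> 'a \<Rightarrow> 'a \<Rightarrow> 'a lpoly" where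
  "subadjacent sA prd a b = prd a b - lsubst sA [- del - lam 0] (prd b a)"


section \<open>The module of conformal linear maps\<close>

definition CHom ::
    "(complex poly \<Rightarrow> 'a::ab_group_add \<Rightarrow> 'a) \<Rightarrow> (complex poly \<Rightarrow> 'm::ab_group_add \<Rightarrow> 'm) \<Rightarrow>
     ('a \<Rightarrow> 'm lpoly) set" where
  "CHom sA sM = {f. (\<forall>a. f a \<in> lpolys UNIV 1) \<and> C_linear sA sM f \<and>
     (\<forall>a. f (sA D a) = lact sM (del + lam 0) (f a))}"

text \<open>
  \<open>(\<partial>f)\<^sub>\<lambda> = -\<lambda> f\<^sub>\<lambda>\<close>, so \<open>p(\<partial>)\<close> acts as \<open>p(-\<lambda>)\<close>. The formula makes sense for all functions; \<open>CHom\<close> is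
  a submodule.
\<close>

definition chom_scale ::
    "(complex poly \<Rightarrow> 'm::ab_group_add \<Rightarrow> 'm) \<Rightarrow> complex poly \<Rightarrow>
     ('a \<Rightarrow> 'm lpoly) \<Rightarrow> ('a \<Rightarrow> 'm lpoly)" where
  "chom_scale sM p f = (\<lambda>a. lact sM (poly (map_poly (\<lambda>c. const [:c:]) p) (- lam 0)) (f a))"

text \<open>Evaluation \<open>F\<^sub>q(b)\<close> of \<open>F \<in> CHom(A,M)[\<lambda>\<^sub>0,\<dots>]\<close>, extended coefficientwise in \<open>F\<close> and \<open>b\<close>.\<close>

definition ceval ::
    "(complex poly \<Rightarrow> 'm::ab_group_add \<Rightarrow> 'm) \<Rightarrow> ('a::zero \<Rightarrow> 'm lpoly) lpoly \<Rightarrow> scalars \<Rightarrow>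
     'a lpoly \<Rightarrow> 'm lpoly" where
  "ceval sM F q b = bil sM (\<lambda>f. f) F q b"

text \<open>
  \<open>chom_act \<dots> a f\<close> is \<open>a\<^sub>\<lambda> f \<in> CHom(A,M)[\<lambda>]\<close>, determined by
  \<open>(a\<^sub>\<lambda> f)\<^bsub>\<lambda>+\<mu>\<^esub>(b) = a\<^sub>\<lambda>(f\<^sub>\<mu>(b)) + f\<^sub>\<mu>(a)\<^bsub>\<lambda>+\<mu>\<^esub> b - f\<^sub>\<mu>(a\<^sub>\<lambda> b)\<close>. For \<open>f \<in> CHom(A,M)\<close> such an
  element exists because \<open>A\<close> is finitely generated, which bounds the degree in \<open>\<lambda>\<close> uniformly in \<open>b\<close>.
\<close>

definition chom_act ::
    "(complex poly \<Rightarrow> 'a::ab_group_add \<Rightarrow> 'a) \<Rightarrow> ('a \<Rightarrow> 'a \<Rightarrow> 'a lpoly) \<Rightarrow>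
     (complex poly \<Rightarrow> 'm::ab_group_add \<Rightarrow> 'm) \<Rightarrow> ('a \<Rightarrow> 'm \<Rightarrow> 'm lpoly) \<Rightarrow>
     ('m \<Rightarrow> 'a \<Rightarrow> 'm lpoly) \<Rightarrow> 'a \<Rightarrow> ('a \<Rightarrow> 'm lpoly) \<Rightarrow> ('a \<Rightarrow> 'm lpoly) lpoly" where
  "chom_act sA prd sM lM rM a f = (THE F. F \<in> lpolys (CHom sA sM) 1 \<and>
     (\<forall>b. ceval sM F (lam 0 + lam 1) (const b) =
        bil sM lM (const a) (lam 0) (ceval sM (const f) (lam 1) (const b))
        + bil sM rM (ceval sM (const f) (lam 1) (const a)) (lam 0 + lam 1) (const b)
        - ceval sM (const f) (lam 1) (bil sA prd (const a) (lam 0) (const b))))"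


section \<open>Cochains\<close>

text \<open>
  An \<open>m\<close>-cochain is a function on lists of length \<open>m\<close> with values in \<open>V[\<lambda>\<^sub>0,\<dots>,\<lambda>\<^bsub>m-2\<^esub>]\<close>, set to \<open>0\<close> on
  lists of any other length. \<open>V\<close> is a submodule of the type carrying \<open>sV\<close>. \<open>lams n\<close> lists
  \<open>\<lambda>\<^sub>0,\<dots>,\<lambda>\<^bsub>n-1\<^esub>\<close>.
\<close>

definition lams :: "nat \<Rightarrow> scalars list" where
  "lams n = map lam [0..<n]"

definition swap :: "nat \<Rightarrow> nat \<Rightarrow> 'x list \<Rightarrow> 'x list" where
  "swap i j xs = xs[i := xs ! j, j := xs ! i]"

text \<open>\<open>omit I xs\<close> drops the entries of \<open>xs\<close> at positions in \<open>I\<close> (the hats).\<close>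

definition omit :: "nat set \<Rightarrow> 'x list \<Rightarrow> 'x list" where
  "omit I xs = nths xs (- I)"

definition cochains ::
    "(complex poly \<Rightarrow> 'r::ab_group_add \<Rightarrow> 'r) \<Rightarrow> (complex poly \<Rightarrow> 'v::ab_group_add \<Rightarrow> 'v) \<Rightarrow>
     'v set \<Rightarrow> nat \<Rightarrow> ('r list \<Rightarrow> 'v lpoly) set" where
  "cochains sR sV V m = {\<gamma>.
     (\<forall>as. length as \<noteq> m \<longrightarrow> \<gamma> as = 0) \<and>
     (\<forall>as. length as = m \<longrightarrow> \<gamma> as \<in> lpolys V (m - 1)) \<and>
     (\<forall>as i. length as = m \<longrightarrow> i < m \<longrightarrow> C_linear sR sV (\<lambda>x. \<gamma> (as[i := x]))) \<and>
     (\<forall>as i. length as = m \<longrightarrow> i < m - 1 \<longrightarrow>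
        \<gamma> (as[i := sR D (as ! i)]) = lact sV (- lam i) (\<gamma> as)) \<and>
     (\<forall>as. length as = m \<longrightarrow>
        \<gamma> (as[m - 1 := sR D (as ! (m - 1))]) = lact sV (del + (\<Sum>k<m - 1. lam k)) (\<gamma> as)) \<and>
     (\<forall>as i j. length as = m \<longrightarrow> i < j \<longrightarrow> j < m - 1 \<longrightarrow>
        lsubst sV (swap i j (lams (m - 1))) (\<gamma> (swap i j as)) = - \<gamma> as)}"

definition lie_cochains ::
    "(complex poly \<Rightarrow> 'r::ab_group_add \<Rightarrow> 'r) \<Rightarrow> (complex poly \<Rightarrow> 'v::ab_group_add \<Rightarrow> 'v) \<Rightarrow>
     'v set \<Rightarrow> nat \<Rightarrow> ('r list \<Rightarrow> 'v lpoly) set" where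
  "lie_cochains sR sV V m = {\<gamma> \<in> cochains sR sV V m.
     \<forall>as i. length as = m \<longrightarrow> i < m - 1 \<longrightarrow>
       \<gamma> as = - lsubst sV ((lams (m - 1))[i := - del - (\<Sum>k<m - 1. lam k)])
                 (\<gamma> (swap i (m - 1) as))}"

text \<open>
  The two differentials, on \<open>m\<close>-cochains. Since indices start at \<open>0\<close>, a sign \<open>(-1)\<^bsup>i+1\<^esup>\<close> becomes
  \<open>(-1)\<^bsup>i\<^esup>\<close>, and \<open>(-1)\<^bsup>i+m+1\<^esup>\<close> becomes \<open>(-1)\<^bsup>i+m\<^esup>\<close>, while \<open>(-1)\<^bsup>i+j\<^esup>\<close> is unchanged.
\<close>

definition d_lie ::
    "(complex poly \<Rightarrow> 'r::ab_group_add \<Rightarrow> 'r) \<Rightarrow> ('r \<Rightarrow> 'r \<Rightarrow> 'r lpoly) \<Rightarrow>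
     (complex poly \<Rightarrow> 'v::ab_group_add \<Rightarrow> 'v) \<Rightarrow> ('r \<Rightarrow> 'v \<Rightarrow> 'v lpoly) \<Rightarrow> nat \<Rightarrow>
     ('r list \<Rightarrow> 'v lpoly) \<Rightarrow> ('r list \<Rightarrow> 'v lpoly)" where
  "d_lie sR br sV act m \<gamma> as =
     (if length as \<noteq> m + 1 then 0 else
      let a = map const as; L = lams m in
        (\<Sum>i<m. lact sV ((-1) ^ i)
           (bil sV act (a ! i) (lam i) (capp sV \<gamma> (omit {i} L) (omit {i} a))))
      + lact sV ((-1) ^ m)
          (bil sV act (a ! m) (- del - (\<Sum>k<m. lam k)) (capp sV \<gamma> (lams (m - 1)) (omit {m} a)))
      + (\<Sum>j<m. \<Sum>i<j. lact sV ((-1) ^ (i + j))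
           (capp sV \<gamma> ((lam i + lam j) # omit {i, j} L)
              (bil sR br (a ! i) (lam i) (a ! j) # omit {i, j} a)))
      + (\<Sum>i<m. lact sV ((-1) ^ (i + m))
           (capp sV \<gamma> (butlast ((- del - (\<Sum>k\<in>{..<m} - {i}. lam k)) # omit {i} L))
              (bil sR br (a ! i) (lam i) (a ! m) # omit {i, m} a))))"

definition d_lsca ::
    "(complex poly \<Rightarrow> 'a::ab_group_add \<Rightarrow> 'a) \<Rightarrow> ('a \<Rightarrow> 'a \<Rightarrow> 'a lpoly) \<Rightarrow>
     (complex poly \<Rightarrow> 'm::ab_group_add \<Rightarrow> 'm) \<Rightarrow> ('a \<Rightarrow> 'm \<Rightarrow> 'm lpoly) \<Rightarrow>
     ('m \<Rightarrow> 'a \<Rightarrow> 'm lpoly) \<Rightarrow> nat \<Rightarrow> ('a list \<Rightarrow> 'm lpoly) \<Rightarrow> ('a list \<Rightarrow> 'm lpoly)" where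
  "d_lsca sA prd sM lM rM m \<gamma> as =
     (if length as \<noteq> m + 1 then 0 else
      let a = map const as; L = lams m in
        (\<Sum>i<m. lact sM ((-1) ^ i)
           (bil sM lM (a ! i) (lam i) (capp sM \<gamma> (omit {i} L) (omit {i} a))))
      + (\<Sum>i<m. lact sM ((-1) ^ i)
           (bil sM rM (capp sM \<gamma> (omit {i} L) (omit {i, m} a @ [a ! i])) (\<Sum>k<m. lam k) (a ! m)))
      - (\<Sum>i<m. lact sM ((-1) ^ i)
           (capp sM \<gamma> (omit {i} L) (omit {i, m} a @ [bil sA prd (a ! i) (lam i) (a ! m)])))
      + (\<Sum>j<m. \<Sum>i<j. lact sM ((-1) ^ (i + j))
           (capp sM \<gamma> ((lam i + lam j) # omit {i, j} L)
              (bil sA (subadjacent sA prd) (a ! i) (lam i) (a ! j) # omit {i, j} a))))"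


section \<open>Cohomology\<close>

text \<open>
  Both complexes start in degree \<open>1\<close>, so there are no nonzero coboundaries in degree \<open>1\<close>. Since
  \<open>H\<^bsup>n-1\<^esup>(g(A), CHom(A,M))\<close> is compared with \<open>H\<^bsup>n\<^esup>(A,M)\<close>, a coboundary space on the Lie side
  requires \<open>n \<ge> 3\<close>; for \<open>n = 2\<close> only the cocycles would correspond.
\<close>

definition cocycles :: "(nat \<Rightarrow> 'c::zero set) \<Rightarrow> (nat \<Rightarrow> 'c \<Rightarrow> 'c) \<Rightarrow> nat \<Rightarrow> 'c set" where
  "cocycles C d m = {\<gamma> \<in> C m. d m \<gamma> = 0}"

definition coboundaries :: "(nat \<Rightarrow> 'c::zero set) \<Rightarrow> (nat \<Rightarrow> 'c \<Rightarrow> 'c) \<Rightarrow> nat \<Rightarrow> 'c set" where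
  "coboundaries C d m = (if m \<le> 1 then {0} else d (m - 1) ` C (m - 1))"

definition cohomology ::
    "(nat \<Rightarrow> 'c::ab_group_add set) \<Rightarrow> (nat \<Rightarrow> 'c \<Rightarrow> 'c) \<Rightarrow> nat \<Rightarrow> 'c set set" where
  "cohomology C d m = (\<lambda>\<gamma>. \<gamma> +o coboundaries C d m) ` cocycles C d m"

definition H_lie ::
    "(complex poly \<Rightarrow> 'r::ab_group_add \<Rightarrow> 'r) \<Rightarrow> ('r \<Rightarrow> 'r \<Rightarrow> 'r lpoly) \<Rightarrow>
     (complex poly \<Rightarrow> 'v::ab_group_add \<Rightarrow> 'v) \<Rightarrow> 'v set \<Rightarrow> ('r \<Rightarrow> 'v \<Rightarrow> 'v lpoly) \<Rightarrow> nat \<Rightarrow>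
     ('r list \<Rightarrow> 'v lpoly) set set" where
  "H_lie sR br sV V act = cohomology (lie_cochains sR sV V) (d_lie sR br sV act)"

definition H_lsca ::
    "(complex poly \<Rightarrow> 'a::ab_group_add \<Rightarrow> 'a) \<Rightarrow> ('a \<Rightarrow> 'a \<Rightarrow> 'a lpoly) \<Rightarrow>
     (complex poly \<Rightarrow> 'm::ab_group_add \<Rightarrow> 'm) \<Rightarrow> ('a \<Rightarrow> 'm \<Rightarrow> 'm lpoly) \<Rightarrow>
     ('m \<Rightarrow> 'a \<Rightarrow> 'm lpoly) \<Rightarrow> nat \<Rightarrow> ('a list \<Rightarrow> 'm lpoly) set set" where
  "H_lsca sA prd sM lM rM = cohomology (cochains sA sM UNIV) (d_lsca sA prd sM lM rM)"

text \<open>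
  The vector space operations on cosets: addition is the setwise sum \<open>X + Y\<close>. For scalars, \<open>c X\<close> is
  completed to a coset by adding \<open>X - X\<close>, the subspace itself; this matters only for \<open>c = 0\<close>.
\<close>

definition cochain_scale ::
    "(complex poly \<Rightarrow> 'v::ab_group_add \<Rightarrow> 'v) \<Rightarrow> complex \<Rightarrow> ('r list \<Rightarrow> 'v lpoly) \<Rightarrow>
     ('r list \<Rightarrow> 'v lpoly)" where
  "cochain_scale s c \<gamma> = (\<lambda>as. lact s (const [:c:]) (\<gamma> as))"

definition coset_scale ::
    "(complex \<Rightarrow> 'c::ab_group_add \<Rightarrow> 'c) \<Rightarrow> complex \<Rightarrow> 'c set \<Rightarrow> 'c set" where
  "coset_scale s c X = s c ` X + {x - y | x y. x \<in> X \<and> y \<in> X}"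

definition quotient_isomorphic ::
    "(complex \<Rightarrow> 'c::ab_group_add \<Rightarrow> 'c) \<Rightarrow> 'c set set \<Rightarrow>
     (complex \<Rightarrow> 'e::ab_group_add \<Rightarrow> 'e) \<Rightarrow> 'e set set \<Rightarrow> bool" where
  "quotient_isomorphic s H t K \<longleftrightarrow> (\<exists>h. bij_betw h H K \<and>
     (\<forall>X\<in>H. \<forall>Y\<in>H. h (X + Y) = h X + h Y) \<and>
     (\<forall>c. \<forall>X\<in>H. h (coset_scale s c X) = coset_scale t c (h X)))"

end

theory Submission
  imports Defs
begin

text \<open>
  A Lie cochain \<open>\<gamma>\<close> with values in \<open>CHom(A,M)\<close> is uncurried to the cochain
  \<open>\<gamma>(a\<^sub>1,\<dots>,a\<^sub>m)\<^sub>\<mu>(a)\<close> of one degree more, where \<open>\<gamma>\<close> has subscripts \<open>\<lambda>\<^sub>1,\<dots>,\<lambda>\<^bsub>m-1\<^esub>\<close> and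
  \<open>\<mu> = \<lambda>\<^sub>1 + \<dots> + \<lambda>\<^sub>m\<close>. Since \<open>\<partial>\<close> acts on \<open>CHom(A,M)\<close> as \<open>-\<mu>\<close>, the subscript
  \<open>-\<partial> - \<lambda>\<^sub>1 - \<dots> - \<lambda>\<^bsub>m-1\<^esub>\<close> turns into \<open>\<lambda>\<^sub>m\<close>: the last argument of \<open>\<gamma>\<close> becomes one of the skew-symmetric
  arguments, and the exceptional terms of \<open>d\<close> become the terms of \<open>\<delta>\<close> with the last index. So uncurrying
  is a map of complexes. It is bijective because \<open>\<lambda>\<^sub>m \<mapsto> \<mu>\<close> is an invertible change of variables and
  because, \<open>A\<close> being finitely generated, the degree in \<open>\<lambda>\<^sub>1, \<dots>, \<lambda>\<^bsub>m-1\<^esub>\<close> is bounded uniformly in the last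
  argument.
\<close>

section \<open>Polynomials with coefficients in a module\<close>

text \<open>The last slot of an (m+1)-cochain obeys the rule with \<partial> plus the sum of all m
  variables, a conformal linear map at subscript \<mu> the rule with \<partial> + \<mu>; this is why
  \<mu> has to be the total. Evaluation at \<mu> turns a scalar acting on CHom into the same scalar
  with \<partial> replaced by -\<mu> (\<open>ceval_lact\<close>), and the comparisons of subscripts
  rest on this one rule. Two obstacles shape the rest. The action on CHom is a definite description,
  which fixes its value only through evaluation at \<lambda> + \<mu>, whereas d uses it with
  subscripts that involve \<partial> and with polynomial arguments; its formula must first be
  carried to that generality (\<open>ceval_bil_chom_act\<close>). And the passage to cosets needs
  injectivity on sums of cocycles and coboundaries, so injectivity is proved on the larger class
  \<open>curried\<close>, which is closed under sums and contains the values of d by a count of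
  variables.\<close>

abbreviation (input) single :: "(nat \<Rightarrow>\<^sub>0 nat) \<Rightarrow> 'v::zero \<Rightarrow> 'v lpoly" where
  "single \<equiv> Poly_Mapping.single"

abbreviation (input) coef :: "'v::zero lpoly \<Rightarrow> (nat \<Rightarrow>\<^sub>0 nat) \<Rightarrow> 'v" where
  "coef \<equiv> Poly_Mapping.lookup"

abbreviation (input) keys :: "'v::zero lpoly \<Rightarrow> (nat \<Rightarrow>\<^sub>0 nat) set" where
  "keys \<equiv> Poly_Mapping.keys"

text \<open>The support of a sum is not determined by the supports, but wherever a coefficient
  vanishes the summand is \<open>g \<alpha> 0 = 0\<close>.\<close>

lemma additive_sum_keys:
  fixes g :: "_ \<Rightarrow> 'v::ab_group_add \<Rightarrow> 'w::ab_group_add"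
  assumes "\<And>\<alpha> u v. g \<alpha> (u + v) = g \<alpha> u + g \<alpha> v"
  shows "additive (\<lambda>P. \<Sum>\<alpha>\<in>keys P. g \<alpha> (coef P \<alpha>))"
proof -
  have "g \<alpha> 0 = 0" for \<alpha>
    using assms[of \<alpha> 0 0] by simp
  then show ?thesis
    by (intro additive.intro setsum_keys_plus_distrib) (auto simp: assms)
qed

lemma sum_keys_single:
  assumes "g \<alpha> 0 = 0"
  shows "(\<Sum>\<beta>\<in>keys (single \<alpha> v). g \<beta> (coef (single \<alpha> v) \<beta>)) = g \<alpha> v"
  using assms by (cases "v = 0") auto

lemma sum_monomials: "(\<Sum>\<alpha>\<in>keys P. single \<alpha> (coef P \<alpha>)) = P"
  by (rule poly_mapping_eqI)
    (auto simp: lookup_sum lookup_single when_def in_keys_iff)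

text \<open>Principle behind most identities below: the operations are sums over supports, hence
  additive, so one monomial at a time suffices. Only exponents in \<open>keys P\<close> are tested,
  which keeps a bound on the variables of \<open>P\<close> available.\<close>

lemma additive_eqI:
  assumes "additive f" "additive g"
    and "\<And>\<alpha>. \<alpha> \<in> keys P \<Longrightarrow> f (single \<alpha> (coef P \<alpha>)) = g (single \<alpha> (coef P \<alpha>))"
  shows "f P = g P"
proof -
  have "f (\<Sum>\<alpha>\<in>keys P. single \<alpha> (coef P \<alpha>)) = g (\<Sum>\<alpha>\<in>keys P. single \<alpha> (coef P \<alpha>))"
    unfolding additive.sum[OF assms(1)] additive.sum[OF assms(2)]
    using assms(3) by simp
  then show ?thesis
    by (simp add: sum_monomials)
qed

lemma additive_sum:
  assumes "\<And>i. i \<in> I \<Longrightarrow> additive (f i)"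
  shows "additive (\<lambda>x. \<Sum>i\<in>I. f i x)"
  using assms by (simp add: additive_def sum.distrib)

lemma additive_mult: "additive ((*) (p::'r::comm_ring_1))" "additive (\<lambda>q::'r. q * p)"
  by (simp_all add: additive_def algebra_simps)

text \<open>Names the product inside \<open>lsubst\<close>, so that its multiplicativity in \<alpha>
  and its behaviour under homomorphisms can be stated.\<close>

definition mon :: "(nat \<Rightarrow> 'r::comm_monoid_mult) \<Rightarrow> (nat \<Rightarrow>\<^sub>0 nat) \<Rightarrow> 'r" where
  "mon \<phi> \<alpha> = (\<Prod>i\<in>Poly_Mapping.keys \<alpha>. \<phi> i ^ Poly_Mapping.lookup \<alpha> i)"

lemma mon_superset:
  "finite I \<Longrightarrow> Poly_Mapping.keys \<alpha> \<subseteq> I \<Longrightarrow>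
    mon \<phi> \<alpha> = (\<Prod>i\<in>I. \<phi> i ^ Poly_Mapping.lookup \<alpha> i)"
  unfolding mon_def by (intro prod.mono_neutral_left) (auto simp: in_keys_iff)

lemma mon_add: "mon \<phi> (\<alpha> + \<beta>) = mon \<phi> \<alpha> * mon \<phi> \<beta>"
proof -
  have "finite (Poly_Mapping.keys \<alpha> \<union> Poly_Mapping.keys \<beta>)" by simp
  then show ?thesis
    using Poly_Mapping.keys_add[of \<alpha> \<beta>]
    by (subst (1 2 3) mon_superset[of "Poly_Mapping.keys \<alpha> \<union> Poly_Mapping.keys \<beta>"])
      (auto simp: lookup_add power_add prod.distrib)
qed

lemma mon_zero [simp]: "mon \<phi> 0 = 1"
  by (simp add: mon_def)

lemma mon_single [simp]: "mon \<phi> (Poly_Mapping.single i k) = \<phi> i ^ k"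
  by (cases "k = 0") (simp_all add: mon_def)

lemma mon_cong: "(\<And>i. i \<in> Poly_Mapping.keys \<alpha> \<Longrightarrow> \<phi> i = \<psi> i) \<Longrightarrow> mon \<phi> \<alpha> = mon \<psi> \<alpha>"
  by (simp add: mon_def)

lemma mon_hom:
  assumes "h 1 = 1" "\<And>p q. h (p * q) = h p * h q"
  shows "h (mon \<phi> \<alpha>) = mon (\<lambda>i. h (\<phi> i)) \<alpha>"
proof -
  have pow: "h (p ^ k) = h p ^ k" for p k
    by (induction k) (simp_all add: assms)
  have "h (\<Prod>i\<in>I. \<phi> i ^ Poly_Mapping.lookup \<alpha> i) = (\<Prod>i\<in>I. h (\<phi> i) ^ Poly_Mapping.lookup \<alpha> i)"
    if "finite I" for I
    using that by (induction I rule: finite_induct) (simp_all add: assms pow)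
  then show ?thesis
    by (simp add: mon_def)
qed

lemma lam_power: "lam i ^ k = single (Poly_Mapping.single i k) 1"
  by (induction k) (simp_all add: lam_def mult_single flip: single_add)

lemma mon_lam: "mon lam \<alpha> = single \<alpha> 1"
proof -
  have "(\<Prod>i\<in>I. lam i ^ Poly_Mapping.lookup \<alpha> i) =
      single (\<Sum>i\<in>I. Poly_Mapping.single i (Poly_Mapping.lookup \<alpha> i)) 1" if "finite I" for I
    using that by (induction I rule: finite_induct) (simp_all add: lam_power mult_single)
  moreover have "(\<Sum>i\<in>Poly_Mapping.keys \<alpha>. Poly_Mapping.single i (Poly_Mapping.lookup \<alpha> i)) = \<alpha>"
    by (rule poly_mapping_eqI) (auto simp: lookup_sum lookup_single when_def in_keys_iff)
  ultimately show ?thesis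
    by (simp add: mon_def)
qed

lemma const_add: "const (u + v) = const u + const v"
  by (simp add: const_def single_add)

lemma const_0 [simp]: "const 0 = 0"
  by (simp add: const_def)

lemma const_1: "const 1 = 1"
  by (simp add: const_def)

lemma const_mult: "const (p * q) = const p * const q"
  by (simp add: const_def mult_single)

section \<open>Action of scalars on polynomials, and substitution for the variables\<close>

locale cd_module = module s for s :: "complex poly \<Rightarrow> 'v::ab_group_add \<Rightarrow> 'v"
begin

lemma additive_lact_inner:
  "additive (\<lambda>P. \<Sum>\<beta>\<in>keys P. single (\<alpha> + \<beta>) (s r (coef P \<beta>)))"
  by (rule additive_sum_keys) (simp add: scale_right_distrib single_add)

lemma lact_additive_left: "additive (\<lambda>q. lact s q P)"
  unfolding lact_def
  by (rule additive_sum_keys) (simp add: scale_left_distrib single_add sum.distrib)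

lemma lact_additive_right: "additive (lact s q)"
  unfolding lact_def by (intro additive_sum additive_lact_inner)

lemmas lact_simps =
  additive.add[OF lact_additive_left] additive.zero[OF lact_additive_left]
  additive.minus[OF lact_additive_left] additive.diff[OF lact_additive_left]
  additive.add[OF lact_additive_right] additive.zero[OF lact_additive_right]
  additive.minus[OF lact_additive_right] additive.diff[OF lact_additive_right]

lemma lact_single [simp]: "lact s (single \<alpha> r) (single \<beta> v) = single (\<alpha> + \<beta>) (s r v)"
proof -
  have "lact s (single \<alpha> r) (single \<beta> v) =
      (\<Sum>\<beta>'\<in>keys (single \<beta> v). single (\<alpha> + \<beta>') (s r (coef (single \<beta> v) \<beta>')))"
    unfolding lact_def by (subst sum_keys_single) simp_all
  also have "\<dots> = single (\<alpha> + \<beta>) (s r v)"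
    by (subst sum_keys_single) simp_all
  finally show ?thesis .
qed

lemma lact_mult: "lact s (p * q) P = lact s p (lact s q P)"
proof -
  have "lact s (single \<alpha> r * q) P = lact s (single \<alpha> r) (lact s q P)" for \<alpha> r
  proof -
    have "lact s (single \<alpha> r * single \<beta> t) P = lact s (single \<alpha> r) (lact s (single \<beta> t) P)" for \<beta> t
      by (rule additive_eqI[where P = P])
        (simp_all add: additive_def lact_simps mult_single add.assoc)
    then show ?thesis
      by (intro additive_eqI[where P = q and f = "\<lambda>q. lact s (_ * q) P"])
        (simp_all add: additive_def lact_simps distrib_left)
  qed
  then show ?thesis
    by (intro additive_eqI[where P = p and f = "\<lambda>p. lact s (p * q) P"])
      (simp_all add: additive_def lact_simps distrib_right)
qed

lemma lact_one [simp]: "lact s 1 P = P"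
proof -
  have "lact s (single 0 1) P = P"
    by (rule additive_eqI[where P = P, OF lact_additive_right]) (simp_all add: additive_def del: single_one)
  then show ?thesis by simp
qed

lemma lact_lact_commute: "lact s p (lact s q P) = lact s q (lact s p P)"
  by (simp add: mult.commute flip: lact_mult)

text \<open>\<open>lsubst\<close> with a function in place of the list: such substitutions compose
  (\<open>ev_ev\<close>) and can be written as \<open>lam(n := ...)\<close>, without side conditions
  on lengths.\<close>

definition ev :: "(nat \<Rightarrow> scalars) \<Rightarrow> 'v lpoly \<Rightarrow> 'v lpoly" where
  "ev \<phi> P = (\<Sum>\<alpha>\<in>keys P. lact s (mon \<phi> \<alpha>) (const (coef P \<alpha>)))"

lemma lsubst_eq_ev: "lsubst s qs P = ev ((!) qs) P"
  by (simp add: lsubst_def ev_def mon_def)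

lemma ev_additive: "additive (ev \<phi>)"
  unfolding ev_def by (rule additive_sum_keys) (simp add: const_add lact_simps)

lemmas ev_simps =
  additive.add[OF ev_additive] additive.zero[OF ev_additive]
  additive.minus[OF ev_additive] additive.diff[OF ev_additive]

lemma ev_single: "ev \<phi> (single \<alpha> v) = lact s (mon \<phi> \<alpha>) (const v)"
  unfolding ev_def by (subst sum_keys_single) (simp_all add: lact_simps)

lemma ev_const [simp]: "ev \<phi> (const v) = const v"
  using ev_single[of \<phi> 0 v] by (simp add: const_def)

text \<open>Needed when a list is read as a function through \<open>(!)\<close>, which is
  unspecified beyond the length.\<close>

lemma ev_cong:
  assumes "P \<in> lpolys V n" "\<And>i. i < n \<Longrightarrow> \<phi> i = \<psi> i"
  shows "ev \<phi> P = ev \<psi> P"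
proof -
  have "mon \<phi> \<alpha> = mon \<psi> \<alpha>" if "\<alpha> \<in> keys P" for \<alpha>
    using that assms unfolding lpolys_def by (intro mon_cong) blast
  then show ?thesis
    by (simp add: ev_def)
qed

lemma ev_lam: "ev lam P = P"
  by (rule additive_eqI[where P = P, OF ev_additive])
    (simp_all add: additive_def ev_single mon_lam const_def)

end

text \<open>The case V = \<complex>[\<partial>]: the ring of scalars acts on itself, so substitution
  in scalars is an instance of \<open>ev\<close> and inherits its rules.\<close>

interpretation scalars: cd_module "(*) :: complex poly \<Rightarrow> complex poly \<Rightarrow> complex poly"
  by unfold_locales (simp_all add: algebra_simps)

lemma lact_scalars: "lact (*) p q = p * q"
proof -
  have "lact (*) (single \<alpha> r) q = single \<alpha> r * q" for \<alpha> r
    by (rule additive_eqI[where P = q, OF scalars.lact_additive_right additive_mult(1)])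
      (simp add: mult_single)
  then show ?thesis
    by (intro additive_eqI[where P = p, OF scalars.lact_additive_left additive_mult(2)])
qed

abbreviation subst :: "(nat \<Rightarrow> scalars) \<Rightarrow> scalars \<Rightarrow> scalars" where
  "subst \<equiv> scalars.ev"

lemma subst_single: "subst \<phi> (single \<alpha> r) = mon \<phi> \<alpha> * const r"
  by (simp add: scalars.ev_single lact_scalars)

context cd_module
begin

lemma const_scale: "const (s r v) = lact s (const r) (const v)"
  by (simp add: const_def)

lemma ev_lact: "ev \<phi> (lact s p P) = lact s (subst \<phi> p) (ev \<phi> P)"
proof -
  have "ev \<phi> (lact s (single \<alpha> r) P) = lact s (subst \<phi> (single \<alpha> r)) (ev \<phi> P)" for \<alpha> r
    by (rule additive_eqI[where P = P])
      (simp_all add: additive_def lact_simps ev_simps ev_single subst_single mon_add const_scale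
        mult_ac flip: lact_mult)
  then show ?thesis
    by (intro additive_eqI[where P = p and f = "\<lambda>p. ev \<phi> (lact s p P)"])
      (simp_all add: additive_def lact_simps ev_simps scalars.ev_simps)
qed

end

lemma subst_mult: "subst \<phi> (p * q) = subst \<phi> p * subst \<phi> q"
  using scalars.ev_lact[of \<phi> p q] by (simp add: lact_scalars)

lemma subst_const [simp]: "subst \<phi> (const r) = const r"
  by (rule scalars.ev_const)

lemma subst_one [simp]: "subst \<phi> 1 = 1"
  using subst_const[of \<phi> 1] by (simp add: const_1)

lemma subst_lam [simp]: "subst \<phi> (lam i) = \<phi> i"
  by (simp add: lam_def subst_single const_1)

lemma subst_del [simp]: "subst \<phi> del = del"
  by (simp add: del_def)

lemma subst_monomial [simp]: "subst \<phi> (single \<alpha> 1) = mon \<phi> \<alpha>"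
  by (simp add: subst_single const_1)

lemma subst_mon: "subst \<psi> (mon \<phi> \<alpha>) = mon (\<lambda>i. subst \<psi> (\<phi> i)) \<alpha>"
  by (rule mon_hom) (simp_all add: subst_mult)

lemmas subst_simps = scalars.ev_simps subst_mult additive.sum[OF scalars.ev_additive]

lemma subst_power: "subst \<phi> (p ^ k) = subst \<phi> p ^ k"
  by (induction k) (simp_all add: subst_mult)

context cd_module
begin

lemma ev_ev: "ev \<psi> (ev \<phi> P) = ev (\<lambda>i. subst \<psi> (\<phi> i)) P"
  by (rule additive_eqI[where P = P])
    (simp_all add: additive_def ev_simps ev_single ev_lact subst_mon)

end

section \<open>Substitution for the derivation, and coefficientwise products\<close>

text \<open>The \<complex>-algebra homomorphism from \<complex>[\<partial>] to the scalars with
  \<partial> \<mapsto> x; the case \<open>x = - lam 0\<close> gives the module structure of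
  CHom.\<close>

definition spoly :: "scalars \<Rightarrow> complex poly \<Rightarrow> scalars" where
  "spoly x r = poly (map_poly (\<lambda>c. const [:c:]) r) x"

lemma spoly_0 [simp]: "spoly x 0 = 0"
  by (simp add: spoly_def)

lemma spoly_pCons: "spoly x (pCons c r) = const [:c:] + x * spoly x r"
  by (simp add: spoly_def map_poly_pCons)

lemma spoly_const [simp]: "spoly x [:c:] = const [:c:]"
  by (simp add: spoly_pCons)

lemma spoly_D [simp]: "spoly x D = x"
  using spoly_const[of x 1] by (simp add: spoly_pCons const_1 flip: one_pCons)

lemma spoly_add: "spoly x (r + t) = spoly x r + spoly x t"
proof (induction r t rule: poly_induct2)
  case (pCons a p b q)
  have "const [:a + b:] = const [:a:] + const [:b:]"
    by (simp flip: const_add)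
  with pCons show ?case
    by (simp add: spoly_pCons algebra_simps)
qed simp

lemma spoly_smult: "spoly x (smult c r) = const [:c:] * spoly x r"
proof (induction r)
  case (pCons a r)
  have "const [:c * a:] = const [:c:] * const [:a:]"
    by (simp add: mult.commute flip: const_mult)
  with pCons show ?case
    by (simp add: spoly_pCons distrib_left mult_ac)
qed simp

lemma spoly_mult: "spoly x (r * t) = spoly x r * spoly x t"
  by (induction r) (simp_all add: spoly_pCons spoly_add spoly_smult algebra_simps)

lemma subst_spoly: "subst \<phi> (spoly x r) = spoly (subst \<phi> x) r"
  by (induction r) (simp_all add: spoly_pCons subst_simps)

text \<open>\<open>dsub q p\<close> replaces \<open>\<partial>\<close> by \<open>q\<close> in \<open>p\<close> and fixes the variables.\<close>

definition dsub :: "scalars \<Rightarrow> scalars \<Rightarrow> scalars" where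
  "dsub q p = (\<Sum>\<alpha>\<in>keys p. single \<alpha> 1 * spoly q (coef p \<alpha>))"

lemma dsub_additive: "additive (dsub q)"
  unfolding dsub_def by (rule additive_sum_keys) (simp add: spoly_add algebra_simps)

lemmas dsub_linear_simps =
  additive.add[OF dsub_additive] additive.zero[OF dsub_additive]
  additive.minus[OF dsub_additive] additive.diff[OF dsub_additive]
  additive.sum[OF dsub_additive]

lemma dsub_single: "dsub q (single \<alpha> r) = single \<alpha> 1 * spoly q r"
  unfolding dsub_def by (subst sum_keys_single) simp_all

lemma dsub_mult: "dsub q (p * p') = dsub q p * dsub q p'"
proof -
  have "dsub q (single \<alpha> r * p') = dsub q (single \<alpha> r) * dsub q p'" for \<alpha> r
  proof (rule additive_eqI[where P = p' and f = "\<lambda>p'. dsub q (_ * p')"])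
    fix \<beta>
    have "single (\<alpha> + \<beta>) 1 = single \<alpha> 1 * single \<beta> (1 :: complex poly)"
      by (simp add: mult_single)
    then show "dsub q (single \<alpha> r * single \<beta> (coef p' \<beta>)) =
        dsub q (single \<alpha> r) * dsub q (single \<beta> (coef p' \<beta>))"
      by (simp add: dsub_single mult_single spoly_mult mult_ac)
  qed (simp_all add: additive_def dsub_linear_simps distrib_left)
  then show ?thesis
    by (intro additive_eqI[where P = p and f = "\<lambda>p. dsub q (p * p')"])
      (simp_all add: additive_def dsub_linear_simps distrib_right)
qed

lemma dsub_const: "dsub q (const r) = spoly q r"
  by (simp add: const_def dsub_single)

lemma dsub_del [simp]: "dsub q del = q"
  by (simp only: del_def dsub_const spoly_D)

lemma dsub_scalar [simp]: "dsub q (const [:c:]) = const [:c:]"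
  by (simp add: dsub_const)

lemma dsub_one [simp]: "dsub q 1 = 1"
  using dsub_scalar[of q 1] by (simp add: const_1 flip: one_pCons)

lemma dsub_monomial [simp]: "dsub q (single \<alpha> 1) = single \<alpha> 1"
  by (simp add: dsub_single spoly_pCons const_1 one_pCons del: single_one flip: const_1)

lemma dsub_lam [simp]: "dsub q (lam i) = lam i"
  by (simp add: lam_def)

lemma dsub_power: "dsub q (p ^ k) = dsub q p ^ k"
  by (induction k) (simp_all add: dsub_mult)

lemma dsub_mon: "dsub q (mon \<phi> \<alpha>) = mon (\<lambda>i. dsub q (\<phi> i)) \<alpha>"
  by (rule mon_hom) (simp_all add: dsub_mult)

lemmas dsub_simps = dsub_linear_simps dsub_mult dsub_power

section \<open>Polynomials in the first n variables with coefficients in a subspace\<close>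

lemma lpolysD:
  assumes "P \<in> lpolys V n" "\<alpha> \<in> keys P"
  shows "Poly_Mapping.keys \<alpha> \<subseteq> {..<n}" "coef P \<alpha> \<in> V"
  using assms by (auto simp: lpolys_def)

lemma lpolys_mono: "P \<in> lpolys V n \<Longrightarrow> V \<subseteq> W \<Longrightarrow> n \<le> m \<Longrightarrow> P \<in> lpolys W m"
  unfolding lpolys_def by (auto; fastforce)

lemma lpolys_single: "Poly_Mapping.keys \<alpha> \<subseteq> {..<n} \<Longrightarrow> v \<in> V \<Longrightarrow> single \<alpha> v \<in> lpolys V n"
  by (simp add: lpolys_def)

lemma lpolys_const: "v \<in> V \<Longrightarrow> const v \<in> lpolys V n"
  by (simp add: const_def lpolys_single)

text \<open>Exponents are natural numbers, so nothing cancels.\<close>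

lemma keys_add_nat: "Poly_Mapping.keys (\<alpha> + \<beta> :: nat \<Rightarrow>\<^sub>0 nat) = Poly_Mapping.keys \<alpha> \<union> Poly_Mapping.keys \<beta>"
  by (auto simp: in_keys_iff lookup_add)

context cd_module
begin

lemma lpolys_zero: "0 \<in> lpolys V n"
  by (simp add: lpolys_def)

lemma lpolys_add:
  assumes "subspace V" "P \<in> lpolys V n" "Q \<in> lpolys V n"
  shows "P + Q \<in> lpolys V n"
proof -
  \<comment> \<open>Off the support the coefficient is 0, which a subspace contains.\<close>
  have "coef P \<alpha> \<in> V" "coef Q \<alpha> \<in> V" for \<alpha>
    using assms subspace_0 unfolding lpolys_def by (metis (mono_tags, lifting) in_keys_iff mem_Collect_eq)+
  then show ?thesis
    using assms Poly_Mapping.keys_add[of P Q]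
    by (auto simp: lpolys_def lookup_add intro!: subspace_add) blast+
qed

lemma lpolys_uminus:
  assumes "subspace V" "P \<in> lpolys V n"
  shows "- P \<in> lpolys V n"
proof -
  have "keys (- P) = keys P"
    by (auto simp: in_keys_iff)
  then show ?thesis
    using assms by (auto simp: lpolys_def intro!: subspace_neg)
qed

lemma lpolys_diff:
  assumes "subspace V" "P \<in> lpolys V n" "Q \<in> lpolys V n"
  shows "P - Q \<in> lpolys V n"
  using lpolys_add[OF assms(1,2) lpolys_uminus[OF assms(1,3)]] by simp

lemma lpolys_sum:
  assumes "subspace V" "\<And>i. i \<in> I \<Longrightarrow> f i \<in> lpolys V n"
  shows "sum f I \<in> lpolys V n"
  using assms(2)
  by (induction I rule: infinite_finite_induct) (auto intro: lpolys_zero lpolys_add[OF assms(1)])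

lemma lpolys_lact:
  assumes V: "subspace V" and "q \<in> lpolys UNIV n" "P \<in> lpolys V n"
  shows "lact s q P \<in> lpolys V n"
  unfolding lact_def
  by (intro lpolys_sum[OF V] lpolys_single subspace_scale[OF V])
    (use lpolysD[OF assms(2)] lpolysD[OF assms(3)] in \<open>auto simp: keys_add_nat\<close>)

end

lemma lpolys_mult: "p \<in> lpolys UNIV n \<Longrightarrow> q \<in> lpolys UNIV n \<Longrightarrow> p * q \<in> lpolys UNIV n"
  for p q :: scalars
  using scalars.lpolys_lact[of UNIV p n q] by (simp add: lact_scalars)

lemma lpolys_one: "(1 :: scalars) \<in> lpolys UNIV n"
  by (simp add: lpolys_const flip: const_1)

lemma lpolys_lam: "i < n \<Longrightarrow> lam i \<in> lpolys UNIV n"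
  by (simp add: lam_def lpolys_single)

lemma lpolys_del: "del \<in> lpolys UNIV n"
  by (simp add: del_def lpolys_const)

lemma lpolys_power: "p \<in> lpolys UNIV n \<Longrightarrow> p ^ k \<in> lpolys UNIV n" for p :: scalars
  by (induction k) (auto intro: lpolys_one lpolys_mult)

lemma lpolys_mon:
  fixes \<phi> :: "nat \<Rightarrow> scalars"
  assumes "\<And>i. i \<in> Poly_Mapping.keys \<alpha> \<Longrightarrow> \<phi> i \<in> lpolys UNIV n"
  shows "mon \<phi> \<alpha> \<in> lpolys UNIV n"
proof -
  have "(\<Prod>i\<in>I. \<phi> i ^ Poly_Mapping.lookup \<alpha> i) \<in> lpolys UNIV n"
    if "finite I" "I \<subseteq> Poly_Mapping.keys \<alpha>" for I
    using that
    by (induction I rule: finite_induct) (auto intro: lpolys_one lpolys_mult lpolys_power assms)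
  then show ?thesis
    by (simp add: mon_def)
qed

lemma spoly_lpolys: "x \<in> lpolys UNIV n \<Longrightarrow> spoly x r \<in> lpolys UNIV n"
proof (induction r)
  case (pCons c r)
  then show ?case
    unfolding spoly_pCons by (intro scalars.lpolys_add lpolys_mult lpolys_const) auto
qed (simp add: scalars.lpolys_zero)

lemmas lpolys_scalar_intros =
  scalars.lpolys_zero scalars.lpolys_add[OF scalars.subspace_UNIV]
  scalars.lpolys_uminus[OF scalars.subspace_UNIV] scalars.lpolys_diff[OF scalars.subspace_UNIV]
  scalars.lpolys_sum[OF scalars.subspace_UNIV]
  lpolys_mult lpolys_one lpolys_lam lpolys_del lpolys_power lpolys_const[OF UNIV_I]

context cd_module
begin

lemma lpolys_ev:
  assumes "subspace V" "P \<in> lpolys V k" "\<And>i. i < k \<Longrightarrow> \<phi> i \<in> lpolys UNIV n"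
  shows "ev \<phi> P \<in> lpolys V n"
  unfolding ev_def
  by (intro lpolys_sum assms(1) lpolys_lact lpolys_mon lpolys_const)
    (use assms lpolysD in blast)+

section \<open>Coefficientwise extension of products\<close>

lemma bil_additive_left:
  assumes "\<And>v. additive (\<lambda>u. op u v)"
  shows "additive (\<lambda>P. bil s op P q Q)"
  unfolding bil_def lsubst_eq_ev
  by (rule additive_sum_keys)
    (simp add: additive.add[OF assms] ev_simps lact_simps sum.distrib)

lemma bil_additive_right:
  assumes "\<And>\<alpha>. additive (op (coef P \<alpha>))"
  shows "additive (bil s op P q)"
  unfolding bil_def lsubst_eq_ev
  by (intro additive_sum additive_sum_keys)
    (simp add: additive.add[OF assms] ev_simps lact_simps)

lemma bil_single_right:
  assumes "\<And>\<alpha>. op (coef P \<alpha>) 0 = 0"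
  shows "bil s op P q (single \<beta> v) =
    (\<Sum>\<alpha>\<in>keys P. lact s (single (\<alpha> + \<beta>) 1) (ev ((!) [q]) (op (coef P \<alpha>) v)))"
  unfolding bil_def lsubst_eq_ev
  by (intro sum.cong refl, subst sum_keys_single) (simp_all add: assms ev_simps lact_simps)

lemma bil_const:
  assumes "op 0 v = 0" "op u 0 = 0"
  shows "bil s op (const u) q (const v) = ev ((!) [q]) (op u v)"
  using assms by (cases "u = 0"; cases "v = 0") (simp_all add: bil_def const_def lsubst_eq_ev ev_simps)

lemma bil_zero [simp]: "bil s op 0 q Q = 0" "bil s op P q 0 = 0"
  by (simp_all add: bil_def)

lemma single_add_one: "lact s (single (\<alpha> + \<beta>) 1) X = lact s (single \<alpha> 1) (lact s (single \<beta> 1) X)"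
  by (simp add: mult_single flip: lact_mult)

lemma lact_sum: "lact s q (sum f I) = (\<Sum>i\<in>I. lact s q (f i))"
  by (rule additive.sum[OF lact_additive_right])

lemma ev_sum: "ev \<phi> (sum f I) = (\<Sum>i\<in>I. ev \<phi> (f i))"
  by (rule additive.sum[OF ev_additive])

lemma bil_expand_right:
  assumes "\<And>\<alpha>. op (coef P \<alpha>) 0 = 0"
  shows "bil s op P q Q = (\<Sum>\<beta>\<in>keys Q. lact s (single \<beta> 1) (bil s op P q (const (coef Q \<beta>))))"
proof -
  have "bil s op P q (const v) =
      (\<Sum>\<alpha>\<in>keys P. lact s (single \<alpha> 1) (ev ((!) [q]) (op (coef P \<alpha>) v)))" for v
    using bil_single_right[where op = op and P = P, OF assms, of q 0 v] by (simp add: const_def)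
  then show ?thesis
    unfolding bil_def lsubst_eq_ev
    by (subst sum.swap) (simp add: lact_sum single_add_one lact_lact_commute)
qed

lemma bil_monomial_right:
  assumes "\<And>\<alpha>. additive (op (coef P \<alpha>))" "module t"
  shows "bil s op P q (lact t (single \<gamma> 1) Q) = lact s (single \<gamma> 1) (bil s op P q Q)"
proof -
  interpret t: cd_module t using assms(2) by (simp add: cd_module_def)
  have [simp]: "op (coef P \<alpha>) 0 = 0" for \<alpha>
    by (rule additive.zero[OF assms(1)])
  show ?thesis
    by (rule additive_eqI[where P = Q and f = "\<lambda>Q. bil s op P q (lact t (single \<gamma> 1) Q)"])
      (simp_all add: additive_def t.lact_simps lact_simps
        additive.add[OF bil_additive_right[where op = op, OF assms(1)]] bil_single_right lact_sum
        add.left_commute single_add_one lact_lact_commute)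
qed

lemma bil_monomial_left:
  assumes "\<And>v. additive (\<lambda>u. op u v)" "module t"
  shows "bil s op (lact t (single \<gamma> 1) P) q Q = lact s (single \<gamma> 1) (bil s op P q Q)"
proof -
  interpret t: cd_module t using assms(2) by (simp add: cd_module_def)
  have left: "bil s op (single \<alpha> u) q Q =
      (\<Sum>\<beta>\<in>keys Q. lact s (single (\<alpha> + \<beta>) 1) (ev ((!) [q]) (op u (coef Q \<beta>))))" for \<alpha> u
    unfolding bil_def lsubst_eq_ev
    by (subst sum_keys_single) (simp_all add: additive.zero[OF assms(1)] ev_simps lact_simps)
  show ?thesis
    by (rule additive_eqI[where P = P and f = "\<lambda>P. bil s op (lact t (single \<gamma> 1) P) q Q"])
      (simp_all add: additive_def t.lact_simps lact_simps
        additive.add[OF bil_additive_left[where op = op, OF assms(1)]] left lact_sum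
        add.assoc single_add_one)
qed

text \<open>With \<open>r = D\<close> and \<open>p = del + lam 0\<close> this is sesquilinearity of
  the extended product: \<partial> on the second argument becomes \<partial> + q.\<close>

lemma bil_constant_right:
  assumes "\<And>\<alpha>. additive (op (coef P \<alpha>))" "module t"
    and "\<And>\<alpha> v. op (coef P \<alpha>) (t r v) = lact s p (op (coef P \<alpha>) v)"
  shows "bil s op P q (lact t (const r) Q) = lact s (subst ((!) [q]) p) (bil s op P q Q)"
proof -
  interpret t: cd_module t using assms(2) by (simp add: cd_module_def)
  have [simp]: "op (coef P \<alpha>) 0 = 0" for \<alpha>
    by (rule additive.zero[OF assms(1)])
  show ?thesis
    by (rule additive_eqI[where P = Q and f = "\<lambda>Q. bil s op P q (lact t (const r) Q)"])
      (simp_all add: additive_def t.lact_simps lact_simps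
        additive.add[OF bil_additive_right[where op = op, OF assms(1)]] bil_single_right lact_sum
        assms(3) const_def ev_lact lact_lact_commute)
qed

end

lemma chom_scale_apply: "chom_scale sM r f a = lact sM (spoly (- lam 0) r) (f a)"
  by (simp add: chom_scale_def spoly_def)

text \<open>\<partial> \<mapsto> -\<lambda> extends to a ring homomorphism; pulling the pointwise
  action of scalars back along it gives a module again.\<close>

lemma cd_module_chom_scale:
  assumes "module sM"
  shows "cd_module (chom_scale sM)"
proof -
  interpret M: cd_module sM using assms by (simp add: cd_module_def)
  show ?thesis
  proof unfold_locales
    show "chom_scale sM 1 f = f" for f :: "'b \<Rightarrow> 'a lpoly"
      using spoly_const[of _ 1] by (simp add: fun_eq_iff chom_scale_apply const_1 flip: one_pCons)
  qed (simp_all add: fun_eq_iff chom_scale_apply M.lact_simps spoly_add spoly_mult M.lact_mult)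
qed

section \<open>Evaluating polynomials with conformal linear coefficients\<close>

context cd_module
begin

lemma bil_lpolys:
  assumes V: "subspace V" and "P \<in> lpolys X n" "Q \<in> lpolys Y n" "q \<in> lpolys UNIV n"
    and op: "\<And>u v. u \<in> X \<Longrightarrow> v \<in> Y \<Longrightarrow> op u v \<in> lpolys V 1"
  shows "bil s op P q Q \<in> lpolys V n"
  unfolding bil_def lsubst_eq_ev
proof (intro lpolys_sum[OF V] lpolys_lact[OF V] lpolys_single)
  fix \<alpha> \<beta> assume "\<alpha> \<in> keys P" "\<beta> \<in> keys Q"
  note * = lpolysD[OF assms(2) this(1)] lpolysD[OF assms(3) this(2)]
  show "Poly_Mapping.keys (\<alpha> + \<beta>) \<subseteq> {..<n}"
    using * by (simp add: keys_add_nat)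
  show "ev ((!) [q]) (op (coef P \<alpha>) (coef Q \<beta>)) \<in> lpolys V n"
    using * assms(4) by (intro lpolys_ev[OF V op]) auto
qed simp

text \<open>
  The coefficient of \<open>\<lambda>\<^sup>\<alpha>\<close> when only the variables other than \<open>\<lambda>\<^sub>n\<close> are counted, with \<open>\<lambda>\<^sub>n\<close> renamed to \<open>\<lambda>\<^sub>0\<close>.
\<close>

definition slice :: "nat \<Rightarrow> (nat \<Rightarrow>\<^sub>0 nat) \<Rightarrow> 'v lpoly \<Rightarrow> 'v lpoly" where
  "slice n \<alpha> P = (\<Sum>\<beta>\<in>keys P.
     if \<beta> - Poly_Mapping.single n (Poly_Mapping.lookup \<beta> n) = \<alpha>
     then single (Poly_Mapping.single 0 (Poly_Mapping.lookup \<beta> n)) (coef P \<beta>) else 0)"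

lemma slice_additive: "additive (slice n \<alpha>)"
  unfolding slice_def by (rule additive_sum_keys) (simp add: single_add)

lemmas slice_simps =
  additive.add[OF slice_additive] additive.zero[OF slice_additive] additive.sum[OF slice_additive]

lemma slice_single:
  "slice n \<alpha> (single \<beta> v) =
    (if \<beta> - Poly_Mapping.single n (Poly_Mapping.lookup \<beta> n) = \<alpha>
     then single (Poly_Mapping.single 0 (Poly_Mapping.lookup \<beta> n)) v else 0)"
  unfolding slice_def by (subst sum_keys_single) simp_all

lemma slice_constant: "slice n \<alpha> (lact s (const r) P) = lact s (const r) (slice n \<alpha> P)"
  by (rule additive_eqI[where P = P])
    (simp_all add: additive_def slice_simps lact_simps slice_single const_def)

text \<open>Multiplication by \<open>lam n\<close> leaves the other exponents alone, so inside a
  slice it is multiplication by the renamed variable. Hence the rule with \<partial> +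
  \<open>lam n\<close> passes to slices as the rule with \<partial> + \<open>lam 0\<close>.\<close>

lemma slice_lam: "slice n \<alpha> (lact s (lam n) P) = lact s (lam 0) (slice n \<alpha> P)"
proof (rule additive_eqI[where P = P])
  fix \<beta> :: "nat \<Rightarrow>\<^sub>0 nat"
  have "Poly_Mapping.single n 1 + \<beta> -
      Poly_Mapping.single n (Poly_Mapping.lookup (Poly_Mapping.single n 1 + \<beta>) n) =
      \<beta> - Poly_Mapping.single n (Poly_Mapping.lookup \<beta> n)"
    by (rule poly_mapping_eqI) (simp add: lookup_add lookup_minus lookup_single when_def)
  then show "slice n \<alpha> (lact s (lam n) (single \<beta> (coef P \<beta>))) =
      lact s (lam 0) (slice n \<alpha> (single \<beta> (coef P \<beta>)))"
    by (simp add: lam_def slice_single lact_simps lookup_add flip: single_add)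
qed (simp_all add: additive_def slice_simps lact_simps)

lemma slice_lpolys: "slice n \<alpha> P \<in> lpolys UNIV 1"
  unfolding slice_def by (intro lpolys_sum subspace_UNIV) (auto intro!: lpolys_single lpolys_zero split: if_splits)

text \<open>Each monomial of \<open>P\<close> lies in exactly one slice. \<open>A\<close> may exceed
  the set of indices that occur, since the further slices are zero.\<close>

lemma slice_reassemble:
  assumes "finite A"
    and "\<And>\<beta>. \<beta> \<in> keys P \<Longrightarrow> \<beta> - Poly_Mapping.single n (Poly_Mapping.lookup \<beta> n) \<in> A"
  shows "(\<Sum>\<alpha>\<in>A. lact s (single \<alpha> 1) (ev ((!) [lam n]) (slice n \<alpha> P))) = P"
proof (rule additive_eqI[where P = P])
  fix \<beta> assume "\<beta> \<in> keys P"
  define k where "k = Poly_Mapping.lookup \<beta> n"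
  have split: "\<beta> - Poly_Mapping.single n k + Poly_Mapping.single n k = \<beta>"
    by (rule poly_mapping_eqI) (simp add: k_def lookup_add lookup_minus lookup_single when_def)
  have "lact s (single \<alpha> 1) (ev ((!) [lam n]) (slice n \<alpha> (single \<beta> v))) =
      (if \<alpha> = \<beta> - Poly_Mapping.single n k then single \<beta> v else 0)" for \<alpha> v
    by (auto simp: slice_single ev_simps lact_simps ev_single lam_power const_def split
        simp flip: k_def)
  then show "(\<Sum>\<alpha>\<in>A. lact s (single \<alpha> 1) (ev ((!) [lam n]) (slice n \<alpha> (single \<beta> (coef P \<beta>))))) =
      single \<beta> (coef P \<beta>)"
    using assms \<open>\<beta> \<in> keys P\<close> by (simp add: k_def)
qed (simp_all add: additive_def slice_simps lact_simps ev_simps sum.distrib)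

text \<open>Since \<alpha>' avoids the variable n, the product still shows which exponents come from
  \<alpha>' and which from \<open>p\<close>; coefficients can thus be read off after
  evaluation.\<close>

lemma slice_monomial:
  assumes "p \<in> lpolys UNIV 1" "Poly_Mapping.keys \<alpha>' \<subseteq> {..<n}"
  shows "slice n \<alpha> (lact s (single \<alpha>' 1) (ev ((!) [lam n]) p)) = (if \<alpha> = \<alpha>' then p else 0)"
proof (rule additive_eqI[where P = p])
  fix \<beta> assume "\<beta> \<in> keys p"
  define k where "k = Poly_Mapping.lookup \<beta> 0"
  have \<beta>: "\<beta> = Poly_Mapping.single 0 k"
    using lpolysD(1)[OF assms(1) \<open>\<beta> \<in> keys p\<close>]
    by (intro poly_mapping_eqI) (auto simp: k_def lookup_single when_def in_keys_iff)
  have "n \<notin> Poly_Mapping.keys \<alpha>'"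
    using assms(2) by auto
  then have "Poly_Mapping.lookup \<alpha>' n = 0"
    by (simp add: in_keys_iff)
  then show "slice n \<alpha> (lact s (single \<alpha>' 1) (ev ((!) [lam n]) (single \<beta> (coef p \<beta>)))) =
      (if \<alpha> = \<alpha>' then single \<beta> (coef p \<beta>) else 0)"
    by (auto simp: \<beta> ev_single lam_power const_def slice_single lookup_add)
qed (simp_all add: additive_def slice_simps lact_simps ev_simps)

end

locale chom_space = U: cd_module sA + V: cd_module sM
  for sA :: "complex poly \<Rightarrow> 'a::ab_group_add \<Rightarrow> 'a"
    and sM :: "complex poly \<Rightarrow> 'm::ab_group_add \<Rightarrow> 'm"
begin

sublocale C: cd_module "chom_scale sM :: complex poly \<Rightarrow> ('a \<Rightarrow> 'm lpoly) \<Rightarrow> ('a \<Rightarrow> 'm lpoly)"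
  by (rule cd_module_chom_scale) unfold_locales

lemma CHomD:
  assumes "f \<in> CHom sA sM"
  shows "additive f" "f 0 = 0" "f a \<in> lpolys UNIV 1"
    "f (sA [:c:] a) = lact sM (const [:c:]) (f a)" "f (sA D a) = lact sM (del + lam 0) (f a)"
proof -
  show "additive f"
    using assms by (simp add: CHom_def C_linear_def additive_def)
  then show "f 0 = 0"
    by (rule additive.zero)
qed (use assms in \<open>simp_all add: CHom_def C_linear_def\<close>)

lemma CHomI:
  assumes "additive f" "\<And>a. f a \<in> lpolys UNIV 1"
    "\<And>c a. f (sA [:c:] a) = lact sM (const [:c:]) (f a)"
    "\<And>a. f (sA D a) = lact sM (del + lam 0) (f a)"
  shows "f \<in> CHom sA sM"
  using assms by (simp add: CHom_def C_linear_def additive_def)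

lemma subspace_CHom: "C.subspace (CHom sA sM)"
proof (rule C.subspaceI)
  show "0 \<in> CHom sA sM"
    by (rule CHomI) (simp_all add: additive_def V.lact_simps V.lpolys_zero)
  show "f + g \<in> CHom sA sM" if "f \<in> CHom sA sM" "g \<in> CHom sA sM" for f g
    using CHomD[OF that(1)] CHomD[OF that(2)]
    by (intro CHomI) (simp_all add: additive_def V.lact_simps V.lpolys_add)
  show "chom_scale sM r f \<in> CHom sA sM" if "f \<in> CHom sA sM" for r f
    using CHomD[OF that]
    by (intro CHomI) (auto simp: additive_def chom_scale_apply V.lact_simps
        V.lact_lact_commute[of _ "spoly _ _"] simp del: One_nat_def
        intro!: V.lpolys_lact spoly_lpolys lpolys_scalar_intros)
qed

lemma ceval_additive: "additive (\<lambda>F. ceval sM F q Q)"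
  unfolding ceval_def by (rule V.bil_additive_left) (simp add: additive_def)

lemmas ceval_simps =
  additive.add[OF ceval_additive] additive.zero[OF ceval_additive]
  additive.minus[OF ceval_additive] additive.diff[OF ceval_additive] additive.sum[OF ceval_additive]

lemma ceval_zero_right [simp]: "ceval sM F q 0 = 0"
  by (simp add: ceval_def)

text \<open>\<open>ceval\<close> sums over the support of \<open>const b\<close>, so it gives 0 at b
  = 0, where an arbitrary function \<open>f\<close> may have another value; the hypothesis excludes
  this clash.\<close>

lemma ceval_single:
  assumes "b \<noteq> 0 \<or> f 0 = 0"
  shows "ceval sM (single \<alpha> f) q (const b) = lact sM (single \<alpha> 1) (V.ev ((!) [q]) (f b))"
  using assms unfolding ceval_def bil_def V.lsubst_eq_ev const_def
  by (cases "f = 0"; cases "b = 0") (auto simp: V.ev_simps V.lact_simps)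

text \<open>On functions \<partial> acts as -\<lambda>, and evaluation puts q for \<lambda>, so
  \<partial> becomes -q while the outer variables stay. This is the purpose of
  \<open>dsub\<close>.\<close>

lemma ceval_lact:
  "ceval sM (lact (chom_scale sM) p F) q (const b) =
    lact sM (dsub (- q) p) (ceval sM F q (const (b :: 'a)))"
proof (cases "b = 0")
  case False
  have "ceval sM (lact (chom_scale sM) (single \<alpha> r) F) q (const b) =
      lact sM (dsub (- q) (single \<alpha> r)) (ceval sM F q (const b))" for \<alpha> r
    using False
    by (intro additive_eqI[where P = F and f = "\<lambda>F. ceval sM (lact (chom_scale sM) _ F) q (const b)"])
      (simp_all add: additive_def ceval_simps C.lact_simps V.lact_simps ceval_single dsub_single
        chom_scale_apply V.ev_lact subst_spoly scalars.ev_simps V.single_add_one V.lact_mult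
        V.lact_lact_commute)
  then show ?thesis
    by (intro additive_eqI[where P = p and
          f = "\<lambda>p. ceval sM (lact (chom_scale sM) p F) q (const b)"])
      (simp_all add: additive_def ceval_simps C.lact_simps V.lact_simps dsub_simps)
qed (simp add: V.lact_simps)

lemma ceval_const:
  assumes "f \<in> CHom sA sM"
  shows "ceval sM (const f) q (const b) = V.ev ((!) [q]) (f b)"
  using ceval_single[of b f 0 q] CHomD(2)[OF assms] by (simp add: const_def)

lemma ceval_sum:
  assumes "F \<in> lpolys (CHom sA sM) n"
  shows "ceval sM F q (const b) = (\<Sum>\<alpha>\<in>keys F. lact sM (single \<alpha> 1) (V.ev ((!) [q]) (coef F \<alpha> b)))"
proof -
  have "ceval sM F q (const b) = ceval sM (\<Sum>\<alpha>\<in>keys F. single \<alpha> (coef F \<alpha>)) q (const b)"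
    by (simp add: sum_monomials)
  also have "\<dots> = (\<Sum>\<alpha>\<in>keys F. lact sM (single \<alpha> 1) (V.ev ((!) [q]) (coef F \<alpha> b)))"
    unfolding ceval_simps using CHomD(2)[OF lpolysD(2)[OF assms]]
    by (intro sum.cong refl ceval_single) auto
  finally show ?thesis .
qed

text \<open>Evaluation at \<mu> rewrites \<partial> as -\<mu> inside \<phi>, which leaves \<psi>;
  the subscript \<sigma> is one that \<psi> carries to \<mu>. Thus values known at one subscript can
  be moved to another.\<close>

lemma ceval_ev:
  assumes F: "F \<in> lpolys (CHom sA sM) n"
    and \<psi>: "\<And>i. i < n \<Longrightarrow> dsub (- \<mu>) (\<phi> i) = \<psi> i" and \<sigma>: "subst \<psi> \<sigma> = \<mu>"
  shows "ceval sM (C.ev \<phi> F) \<mu> (const b) = V.ev \<psi> (ceval sM F \<sigma> (const b))"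
proof -
  have "dsub (- \<mu>) (mon \<phi> \<alpha>) = mon \<psi> \<alpha>" if "\<alpha> \<in> keys F" for \<alpha>
    unfolding dsub_mon using lpolysD(1)[OF F that] \<psi> by (intro mon_cong) auto
  then have "ceval sM (C.ev \<phi> F) \<mu> (const b) =
      (\<Sum>\<alpha>\<in>keys F. lact sM (mon \<psi> \<alpha>) (V.ev ((!) [\<mu>]) (coef F \<alpha> b)))"
    unfolding C.ev_def ceval_simps ceval_lact
    by (intro sum.cong refl) (simp add: ceval_const[OF lpolysD(2)[OF F]])
  also have "V.ev ((!) [\<mu>]) (coef F \<alpha> b) = V.ev \<psi> (V.ev ((!) [\<sigma>]) (coef F \<alpha> b))"
    if "\<alpha> \<in> keys F" for \<alpha>
    unfolding V.ev_ev using \<sigma>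
    by (intro V.ev_cong[OF CHomD(3)[OF lpolysD(2)[OF F that]]]) simp
  then have "(\<Sum>\<alpha>\<in>keys F. lact sM (mon \<psi> \<alpha>) (V.ev ((!) [\<mu>]) (coef F \<alpha> b))) =
      V.ev \<psi> (ceval sM F \<sigma> (const b))"
    unfolding ceval_sum[OF F] V.ev_sum by (intro sum.cong refl) (simp add: V.ev_lact)
  finally show ?thesis .
qed

text \<open>The variable n does not occur in the exponents of \<open>F\<close>, so evaluation at
  \<open>lam n\<close> mixes no two coefficients, and slices recover each of them.\<close>

lemma ceval_lam_inject:
  assumes F: "F \<in> lpolys (CHom sA sM) n" and "\<And>b. ceval sM F (lam n) (const b) = 0"
  shows "F = 0"
proof (rule poly_mapping_eqI)
  fix \<alpha>
  show "coef F \<alpha> = coef 0 \<alpha>"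
  proof (cases "\<alpha> \<in> keys F")
    case True
    have "coef F \<alpha> b = 0" for b
    proof -
      have "0 = V.slice n \<alpha> (ceval sM F (lam n) (const b))"
        by (simp add: assms(2) V.slice_simps)
      also have "\<dots> = (\<Sum>\<alpha>'\<in>keys F. if \<alpha> = \<alpha>' then coef F \<alpha>' b else 0)"
        unfolding ceval_sum[OF F] V.slice_simps
        by (intro sum.cong refl V.slice_monomial lpolysD(1)[OF F] CHomD(3)[OF lpolysD(2)[OF F]])
      also have "\<dots> = coef F \<alpha> b"
        using True by simp
      finally show ?thesis ..
    qed
    then show ?thesis
      by (simp add: fun_eq_iff)
  qed (simp add: in_keys_iff)
qed

lemma ceval_total_inject:
  assumes "F \<in> lpolys (CHom sA sM) n" "G \<in> lpolys (CHom sA sM) n"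
    and "\<And>b. ceval sM F (\<Sum>k<Suc n. lam k) (const b) = ceval sM G (\<Sum>k<Suc n. lam k) (const b)"
  shows "F = G"
proof -
  \<comment> \<open>Triangular change of variables that takes the total sum to
    \<open>lam n\<close>.\<close>
  define \<psi> where "\<psi> = lam(n := lam n - (\<Sum>k<n. lam k))"
  have FG: "F - G \<in> lpolys (CHom sA sM) n"
    using assms(1,2) by (intro C.lpolys_diff subspace_CHom)
  \<comment> \<open>\<open>C.ev lam\<close> is the identity; it gives the left side the shape of
    \<open>ceval_ev\<close>.\<close>
  have "ceval sM (C.ev lam (F - G)) (lam n) (const b) =
      V.ev \<psi> (ceval sM (F - G) (\<Sum>k<Suc n. lam k) (const b))" for b
    by (rule ceval_ev[OF FG]) (simp_all add: \<psi>_def subst_simps)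
  then have "ceval sM (F - G) (lam n) (const b) = 0" for b
    by (simp only: C.ev_lam ceval_simps assms(3) V.ev_simps diff_self)
  then have "F - G = 0"
    by (rule ceval_lam_inject[OF FG])
  then show ?thesis by simp
qed

lemma additive_C_linear: "C_linear sA sM W \<Longrightarrow> additive W"
  by (simp add: C_linear_def additive_def)

text \<open>
  Finite generation bounds the degree of \<open>W b\<close> in \<open>\<lambda>\<^sub>0, \<dots>, \<lambda>\<^bsub>n-1\<^esub>\<close> uniformly in \<open>b\<close>: a monomial that
  is absent from \<open>W b\<close> for all generators \<open>b\<close> is absent from all \<open>W b\<close>.
\<close>

lemma ceval_lam_exists:
  assumes fg: "finitely_generated sA"
    and W: "\<And>b. W b \<in> lpolys UNIV (Suc n)" "C_linear sA sM W"
      "\<And>b. W (sA D b) = lact sM (del + lam n) (W b)"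
  shows "\<exists>F\<in>lpolys (CHom sA sM) n. \<forall>b. ceval sM F (lam n) (const b) = W b"
proof -
  note [simp] = additive.add[OF additive_C_linear[OF W(2)]] additive.zero[OF additive_C_linear[OF W(2)]]
  have W_scalar: "W (sA [:c:] b) = lact sM (const [:c:]) (W b)" for c b
    using W(2) by (simp add: C_linear_def)
  define rest where "rest \<beta> = \<beta> - Poly_Mapping.single n (Poly_Mapping.lookup \<beta> n)" for \<beta> :: "nat \<Rightarrow>\<^sub>0 nat"
  \<comment> \<open>The coefficients of the future \<open>F\<close>: slices of \<open>W b\<close>,
    read as functions of b.\<close>
  define f where "f \<alpha> b = V.slice n \<alpha> (W b)" for \<alpha> b
  have f_scalar: "f \<alpha> (sA [:c:] b) = lact sM (const [:c:]) (f \<alpha> b)" for \<alpha> c b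
    by (simp add: f_def W_scalar V.slice_constant)
  have f_D: "f \<alpha> (sA D b) = lact sM (del + lam 0) (f \<alpha> b)" for \<alpha> b
    unfolding f_def W(3)
    by (simp add: V.lact_simps V.slice_simps V.slice_lam V.slice_constant del_def)
  have f_additive: "additive (f \<alpha>)" for \<alpha>
    by (simp add: f_def additive_def V.slice_simps)
  have f_CHom: "f \<alpha> \<in> CHom sA sM" for \<alpha>
    by (intro CHomI f_additive f_scalar f_D) (use V.slice_lpolys in \<open>simp add: f_def\<close>)
  have f_rest: "f \<alpha> b = 0" if "\<alpha> \<notin> rest ` keys (W b)" for \<alpha> b
    using that unfolding f_def V.slice_def rest_def by (intro sum.neutral) auto
  obtain B where B: "finite B" "U.span B = UNIV"
    using fg unfolding finitely_generated_def by auto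
  define A where "A = (\<Union>b\<in>B. rest ` keys (W b))"
  have f_zero: "f \<alpha> b = 0" if "\<alpha> \<notin> A" for \<alpha> b
  proof -
    \<comment> \<open>Induction over r = c + t\<partial> with x general: \<partial>x is again a zero
      because \<open>f \<alpha>\<close> turns \<partial> into \<partial> + \<lambda>. So the zeros
      form a submodule, and it suffices to check generators.\<close>
    have scale: "f \<alpha> (sA r x) = 0" if "f \<alpha> x = 0" for r x
      using that
    proof (induction r arbitrary: x)
      case (pCons c r)
      have "pCons c r = [:c:] + r * D"
        by simp
      then have "sA (pCons c r) x = sA [:c:] x + sA r (sA D x)"
        by (metis U.scale_left_distrib U.scale_scale)
      moreover have "f \<alpha> (sA [:c:] x) = 0" "f \<alpha> (sA r (sA D x)) = 0"
        using pCons by (simp_all only: f_scalar f_D V.lact_simps)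
      ultimately show ?case
        by (simp only: additive.add[OF f_additive] add_0)
    qed (simp add: additive.zero[OF f_additive])
    have "U.subspace {b. f \<alpha> b = 0}"
      using scale
      by (intro U.subspaceI) (simp_all add: additive.add[OF f_additive] additive.zero[OF f_additive])
    moreover have "B \<subseteq> {b. f \<alpha> b = 0}"
      using that f_rest by (auto simp: A_def)
    ultimately show ?thesis
      using U.span_minimal[of B] B(2) by auto
  qed
  define F where "F = (\<Sum>\<alpha>\<in>A. single \<alpha> (f \<alpha>))"
  have "finite A"
    using B(1) by (simp add: A_def)
  have "Poly_Mapping.keys (rest \<beta>) \<subseteq> {..<n}" if "\<beta> \<in> keys (W b)" for \<beta> b
  proof
    fix i assume i: "i \<in> Poly_Mapping.keys (rest \<beta>)"
    then have "i \<noteq> n"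
      by (auto simp: rest_def in_keys_iff lookup_minus)
    moreover have "i \<in> Poly_Mapping.keys \<beta>"
      using i by (auto simp: rest_def in_keys_iff lookup_minus)
    then have "i < Suc n"
      using lpolysD(1)[OF W(1) that] by auto
    ultimately show "i \<in> {..<n}" by simp
  qed
  then have "F \<in> lpolys (CHom sA sM) n"
    unfolding F_def A_def by (intro C.lpolys_sum[OF subspace_CHom] lpolys_single f_CHom) auto
  moreover have "ceval sM F (lam n) (const b) = W b" for b
  proof -
    have "ceval sM F (lam n) (const b) =
        (\<Sum>\<alpha>\<in>A. lact sM (single \<alpha> 1) (V.ev ((!) [lam n]) (f \<alpha> b)))"
      unfolding F_def ceval_simps using CHomD(2)[OF f_CHom] by (intro sum.cong refl ceval_single) auto
    \<comment> \<open>Enlarging the index set until it visibly covers \<open>W b\<close> only adds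
      zero terms, by \<open>f_zero\<close>.\<close>
    also have "\<dots> = (\<Sum>\<alpha>\<in>A \<union> rest ` keys (W b). lact sM (single \<alpha> 1) (V.ev ((!) [lam n]) (f \<alpha> b)))"
      using \<open>finite A\<close> f_zero by (intro sum.mono_neutral_left) (auto simp: V.ev_simps V.lact_simps)
    also have "\<dots> = W b"
      unfolding f_def using \<open>finite A\<close> by (intro V.slice_reassemble) (auto simp: rest_def)
    finally show ?thesis .
  qed
  ultimately show ?thesis by blast
qed

lemma ceval_total_exists:
  assumes fg: "finitely_generated sA"
    and W: "\<And>b. W b \<in> lpolys UNIV (Suc n)" "C_linear sA sM W"
      "\<And>b. W (sA D b) = lact sM (del + (\<Sum>k<Suc n. lam k)) (W b)"
  shows "\<exists>F\<in>lpolys (CHom sA sM) n. \<forall>b. ceval sM F (\<Sum>k<Suc n. lam k) (const b) = W b"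
proof -
  \<comment> \<open>\<psi> takes the total sum to \<open>lam n\<close> and \<psi>' undoes it:
    \<open>F\<close> is constructed at the subscript \<open>lam n\<close>, then its values are
    transported back.\<close>
  define \<psi> where "\<psi> = lam(n := lam n - (\<Sum>k<n. lam k))"
  define \<psi>' where "\<psi>' = lam(n := \<Sum>k<Suc n. lam k)"
  have "\<exists>F\<in>lpolys (CHom sA sM) n. \<forall>b. ceval sM F (lam n) (const b) = V.ev \<psi> (W b)"
  proof (rule ceval_lam_exists[OF fg])
    show "V.ev \<psi> (W b) \<in> lpolys UNIV (Suc n)" for b
      by (rule V.lpolys_ev[OF V.subspace_UNIV W(1)])
        (auto simp: \<psi>_def intro!: lpolys_scalar_intros)
    show "C_linear sA sM (\<lambda>b. V.ev \<psi> (W b))"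
      using W(2) by (simp add: C_linear_def V.ev_simps V.ev_lact)
    show "V.ev \<psi> (W (sA D b)) = lact sM (del + lam n) (V.ev \<psi> (W b))" for b
      by (simp add: W(3) V.ev_lact subst_simps \<psi>_def)
  qed
  then obtain F where F: "F \<in> lpolys (CHom sA sM) n"
    and eq: "\<And>b. ceval sM F (lam n) (const b) = V.ev \<psi> (W b)"
    by blast
  have "ceval sM F (\<Sum>k<Suc n. lam k) (const b) = W b" for b
  proof -
    have "ceval sM (C.ev lam F) (\<Sum>k<Suc n. lam k) (const b) = V.ev \<psi>' (ceval sM F (lam n) (const b))"
      by (rule ceval_ev[OF F]) (simp_all add: \<psi>'_def)
    also have "\<dots> = V.ev lam (W b)"
      unfolding eq V.ev_ev by (rule V.ev_cong[OF W(1)]) (auto simp: \<psi>_def \<psi>'_def subst_simps)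
    finally show ?thesis
      by (simp add: C.ev_lam V.ev_lam)
  qed
  with F show ?thesis by blast
qed

end

section \<open>The action on conformal linear maps\<close>

text \<open>Instantiated for both actions on \<open>M\<close> and for the product of
  \<open>A\<close>, so that the rules for the extended products are derived once.\<close>

locale conformal = U: cd_module sU + V: cd_module sV + W: cd_module sW
  for sU :: "complex poly \<Rightarrow> 'u::ab_group_add \<Rightarrow> 'u"
    and sV :: "complex poly \<Rightarrow> 'v::ab_group_add \<Rightarrow> 'v"
    and sW :: "complex poly \<Rightarrow> 'w::ab_group_add \<Rightarrow> 'w" +
  fixes op :: "'u \<Rightarrow> 'v \<Rightarrow> 'w lpoly"
  assumes product: "conformal_product sU sV sW op"
begin

lemma additive_left: "additive (\<lambda>u. op u v)"
  and additive_right: "additive (op u)"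
  and op_lpolys: "op u v \<in> lpolys UNIV 1"
  and op_scalar: "op u (sV [:c:] v) = lact sW (const [:c:]) (op u v)"
  and op_del: "op u (sV D v) = lact sW (del + lam 0) (op u v)"
  using product by (simp_all add: conformal_product_def C_linear_def additive_def)

lemma op_zero: "op 0 v = 0" "op u 0 = 0"
  by (rule additive.zero[OF additive_left], rule additive.zero[OF additive_right])

lemmas bil_additive = W.bil_additive_left[where op = op, OF additive_left]
  W.bil_additive_right[where op = op, OF additive_right]

lemma bil_constants: "bil sW op (const u) q (const v) = W.ev ((!) [q]) (op u v)"
  by (rule W.bil_const) (simp_all add: op_zero)

lemma bil_lam_right: "bil sW op P q (lact sV (lam k) Q) = lact sW (lam k) (bil sW op P q Q)"
  unfolding lam_def by (intro W.bil_monomial_right additive_right) unfold_locales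

lemma bil_lam_left: "bil sW op (lact sU (lam k) P) q Q = lact sW (lam k) (bil sW op P q Q)"
  unfolding lam_def by (intro W.bil_monomial_left additive_left) unfold_locales

lemma bil_scalar_right:
  "bil sW op P q (lact sV (const [:c:]) Q) = lact sW (const [:c:]) (bil sW op P q Q)"
  using W.bil_constant_right[where op = op and P = P and t = sV and p = "const [:c:]" and q = q]
  by (simp add: additive_right op_scalar V.module_axioms)

lemma bil_del_right: "bil sW op P q (lact sV del Q) = lact sW (del + q) (bil sW op P q Q)"
  using W.bil_constant_right[where op = op and P = P and t = sV and p = "del + lam 0" and q = q and r = D]
  by (simp add: additive_right op_del V.module_axioms subst_simps flip: del_def)

end

lemma commute_sum_lam:
  assumes "cd_module t" "cd_module s" "additive T"
    and "\<And>k Q. T (lact t (lam k) Q) = lact s (lam k) (T Q)"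
  shows "T (lact t (\<Sum>k\<in>S. lam k) Q) = lact s (\<Sum>k\<in>S. lam k) (T Q)"
proof -
  interpret t: cd_module t by fact
  interpret s: cd_module s by fact
  show ?thesis
    by (simp add: additive.sum[OF t.lact_additive_left] additive.sum[OF s.lact_additive_left]
        additive.sum[OF assms(3)] assms(4))
qed

lemma commute_power:
  assumes "cd_module t" "cd_module s"
    and "\<And>Q. T (lact t \<rho> Q) = lact s \<rho> (T Q)"
  shows "T (lact t (\<rho> ^ k) Q) = lact s (\<rho> ^ k) (T Q)"
proof -
  interpret t: cd_module t by fact
  interpret s: cd_module s by fact
  show ?thesis
    by (induction k arbitrary: Q) (simp_all add: t.lact_mult s.lact_mult assms(3))
qed

text \<open>\<open>T\<close> commutes with \<open>lam j\<close> and \<open>T'\<close> with \<rho>,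
  so powers of the inner subscript come out on both sides and \<psi> turns one into the other; only
  constants remain to be compared. Serves each of the three terms of the action formula.\<close>

lemma ev_transfer:
  assumes t: "cd_module t" and s: "cd_module s" and T: "additive T" "additive T'"
    and comm: "\<And>Q. T (lact t (lam j) Q) = lact s (lam j) (T Q)"
      "\<And>Q. T' (lact t \<rho> Q) = lact s \<rho> (T' Q)"
    and base: "\<And>v. cd_module.ev s \<psi> (T (const v)) = T' (const v)" and "\<psi> j = \<rho>"
    and P: "P \<in> lpolys UNIV 1"
  shows "cd_module.ev s \<psi> (T (cd_module.ev t ((!) [lam j]) P)) =
    T' (cd_module.ev t ((!) [\<rho>]) P)"
proof -
  interpret t: cd_module t by fact
  interpret s: cd_module s by fact
  note comm' = commute_power[OF t s, of T, OF comm(1)] commute_power[OF t s, of T', OF comm(2)]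
  have "s.ev \<psi> (T (t.ev ((!) [lam j]) (single \<beta> v))) = T' (t.ev ((!) [\<rho>]) (single \<beta> v))"
    if "\<beta> \<in> keys P" for \<beta> v
  proof -
    define k where "k = Poly_Mapping.lookup \<beta> 0"
    have \<beta>: "\<beta> = Poly_Mapping.single 0 k"
      using lpolysD(1)[OF P that]
      by (intro poly_mapping_eqI) (auto simp: k_def lookup_single when_def in_keys_iff)
    show ?thesis
      by (simp add: \<beta> t.ev_single comm' s.ev_lact subst_power \<open>\<psi> j = \<rho>\<close> base)
  qed
  then show ?thesis
    by (intro additive_eqI[where P = P and f = "\<lambda>P. s.ev \<psi> (T (t.ev ((!) [lam j]) P))"])
      (simp_all add: additive_def t.ev_simps s.ev_simps additive.add[OF T(1)] additive.add[OF T(2)])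
qed

context chom_space
begin

text \<open>Off the support too, since CHom contains 0; the rules for \<open>bil\<close> ask for
  every \<alpha>.\<close>

lemma coef_CHom: "F \<in> lpolys (CHom sA sM) n \<Longrightarrow> coef F \<alpha> \<in> CHom sA sM"
  using lpolysD(2) C.subspace_0[OF subspace_CHom] by (cases "\<alpha> \<in> keys F") (auto simp: in_keys_iff)

lemma ceval_additive_right: "F \<in> lpolys (CHom sA sM) n \<Longrightarrow> additive (ceval sM F q)"
  unfolding ceval_def by (intro V.bil_additive_right CHomD coef_CHom)

lemma ceval_lam_right:
  "F \<in> lpolys (CHom sA sM) n \<Longrightarrow>
    ceval sM F q (lact sA (lam k) Q) = lact sM (lam k) (ceval sM F q Q)"
  unfolding ceval_def lam_def
  by (intro V.bil_monomial_right CHomD coef_CHom) (assumption, unfold_locales)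

lemma ceval_scalar_right:
  "F \<in> lpolys (CHom sA sM) n \<Longrightarrow>
    ceval sM F q (lact sA (const [:c:]) Q) = lact sM (const [:c:]) (ceval sM F q Q)"
  using V.bil_constant_right[where op = "\<lambda>f. f" and P = F and t = sA and p = "const [:c:]" and q = q]
  by (simp add: ceval_def CHomD(1,4)[OF coef_CHom] U.module_axioms)

lemma ceval_del_right:
  "F \<in> lpolys (CHom sA sM) n \<Longrightarrow>
    ceval sM F q (lact sA del Q) = lact sM (del + q) (ceval sM F q Q)"
  using V.bil_constant_right[where op = "\<lambda>f. f" and P = F and t = sA and p = "del + lam 0" and q = q and r = D]
  by (simp add: ceval_def CHomD(1,5)[OF coef_CHom] U.module_axioms subst_simps flip: del_def)

lemma ceval_expand_right:
  "F \<in> lpolys (CHom sA sM) n \<Longrightarrow>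
    ceval sM F q Q = (\<Sum>\<beta>\<in>keys Q. lact sM (single \<beta> 1) (ceval sM F q (const (coef Q \<beta>))))"
  unfolding ceval_def by (intro V.bil_expand_right CHomD coef_CHom)

lemma const_CHom: "f \<in> CHom sA sM \<Longrightarrow> const f \<in> lpolys (CHom sA sM) 0"
  by (rule lpolys_const)

lemma ceval_lpolys:
  "F \<in> lpolys (CHom sA sM) n \<Longrightarrow> Q \<in> lpolys UNIV n \<Longrightarrow> q \<in> lpolys UNIV n \<Longrightarrow>
    ceval sM F q Q \<in> lpolys UNIV n"
  unfolding ceval_def by (rule V.bil_lpolys[OF V.subspace_UNIV]) (use CHomD(3) in auto)

end

section \<open>The action recovered from its values, for general subscripts and arguments\<close>

sublocale lsca_module \<subseteq> chom_space sA sM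
  by unfold_locales

context lsca_module
begin

sublocale L: conformal sA sM sM lM
  by unfold_locales (rule left_product)

sublocale R: conformal sM sA sM rM
  by unfold_locales (rule right_product)

sublocale P: conformal sA sA sA prd
  by unfold_locales (rule A.product)

abbreviation act :: "'a \<Rightarrow> ('a \<Rightarrow> 'm lpoly) \<Rightarrow> ('a \<Rightarrow> 'm lpoly) lpoly" where
  "act \<equiv> chom_act sA prd sM lM rM"

text \<open>The defining formula of \<open>a\<^sub>\<lambda> f\<close> with \<open>\<lambda> = q\<close> and \<open>\<mu> = \<rho>\<close>.\<close>

definition action :: "scalars \<Rightarrow> scalars \<Rightarrow> 'a \<Rightarrow> ('a \<Rightarrow> 'm lpoly) lpoly \<Rightarrow> 'a lpoly \<Rightarrow> 'm lpoly" where
  "action q \<rho> a G Q = bil sM lM (const a) q (ceval sM G \<rho> Q)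
     + bil sM rM (ceval sM G \<rho> (const a)) (q + \<rho>) Q
     - ceval sM G \<rho> (bil sA prd (const a) q Q)"

lemma action_additive_right:
  "G \<in> lpolys (CHom sA sM) n \<Longrightarrow> additive (action q \<rho> a G)"
  using additive.add[OF ceval_additive_right[of G n]] additive.add[OF L.bil_additive(2)]
    additive.add[OF R.bil_additive(2)] additive.add[OF P.bil_additive(2)]
  by (simp add: action_def additive_def algebra_simps)

lemma action_scalar_right:
  "G \<in> lpolys (CHom sA sM) n \<Longrightarrow>
    action q \<rho> a G (lact sA (const [:c:]) Q) = lact sM (const [:c:]) (action q \<rho> a G Q)"
  by (simp add: action_def ceval_scalar_right L.bil_scalar_right R.bil_scalar_right
      P.bil_scalar_right V.lact_simps)

text \<open>In each of the three terms \<partial> picks up \<open>lam i\<close> and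
  \<open>lam j\<close>: one after the other when two products are nested around \<open>Q\<close>, at
  once in the middle term, whose subscript is their sum.\<close>

lemma action_del_right:
  assumes G: "G \<in> lpolys (CHom sA sM) n"
  shows "action (lam i) (lam j) a G (lact sA del Q) =
    lact sM (del + (lam i + lam j)) (action (lam i) (lam j) a G Q)"
  using additive.add[OF ceval_additive_right[OF G]] additive.add[OF L.bil_additive(2)]
    additive.add[OF P.bil_additive(2)] additive.add[OF R.bil_additive(2)]
  by (simp add: action_def ceval_del_right[OF G] ceval_lam_right[OF G] L.bil_del_right R.bil_del_right
      P.bil_del_right L.bil_lam_right P.bil_lam_right V.lact_simps U.lact_simps algebra_simps)

text \<open>Existence for the description in \<open>chom_act\<close>: its right side is linear in b,
  and \<partial> on b comes out as \<partial> + \<open>lam 0 + lam 1\<close>, the total for two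
  variables, as \<open>ceval_total_exists\<close> requires.\<close>

lemma chom_act_exists:
  assumes f: "f \<in> CHom sA sM"
  shows "\<exists>F\<in>lpolys (CHom sA sM) 1. \<forall>b.
    ceval sM F (\<Sum>k<Suc 1. lam k) (const b) = action (lam 0) (lam 1) a (const f) (const b)"
proof (rule ceval_total_exists[OF A.fg])
  note F = const_CHom[OF f]
  \<comment> \<open>Also with two variables, because \<open>ceval_lpolys\<close> uses one bound for
    coefficients, argument and subscript.\<close>
  have F2: "const f \<in> lpolys (CHom sA sM) (Suc 1)"
    using f by (rule lpolys_const)
  show "action (lam 0) (lam 1) a (const f) (const b) \<in> lpolys UNIV (Suc 1)" for b
    unfolding action_def
    by (intro V.lpolys_diff V.lpolys_add M.subspace_UNIV V.bil_lpolys[where X = UNIV and Y = UNIV]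
        ceval_lpolys[OF F2] U.bil_lpolys[where X = UNIV and Y = UNIV] lpolys_scalar_intros
        A.subspace_UNIV lpolys_const UNIV_I L.op_lpolys R.op_lpolys P.op_lpolys) simp_all
  show "C_linear sA sM (\<lambda>b. action (lam 0) (lam 1) a (const f) (const b))"
    unfolding C_linear_def const_add U.const_scale
    by (simp add: additive.add[OF action_additive_right[OF F]] action_scalar_right[OF F])
  show "action (lam 0) (lam 1) a (const f) (const (sA D b)) =
      lact sM (del + (\<Sum>k<Suc 1. lam k)) (action (lam 0) (lam 1) a (const f) (const b))" for b
    using action_del_right[OF F, of 0 1 a "const b"]
    unfolding U.const_scale by (simp flip: del_def)
qed

lemma chom_act:
  assumes f: "f \<in> CHom sA sM"
  shows "act a f \<in> lpolys (CHom sA sM) 1"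
    and "ceval sM (act a f) (lam 0 + lam 1) (const b) = action (lam 0) (lam 1) a (const f) (const b)"
proof -
  let ?P = "\<lambda>F. F \<in> lpolys (CHom sA sM) 1 \<and>
    (\<forall>b. ceval sM F (lam 0 + lam 1) (const b) = action (lam 0) (lam 1) a (const f) (const b))"
  have total: "(\<Sum>k<Suc 1. lam k) = lam 0 + lam 1"
    by simp
  have "\<exists>!F. ?P F"
    using chom_act_exists[OF f, of a] ceval_total_inject[of _ 1] unfolding total by metis
  then have "?P (THE F. ?P F)"
    by (rule theI')
  then have "?P (act a f)"
    unfolding chom_act_def action_def .
  then show "act a f \<in> lpolys (CHom sA sM) 1"
    and "ceval sM (act a f) (lam 0 + lam 1) (const b) = action (lam 0) (lam 1) a (const f) (const b)"
    by auto
qed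

text \<open>The formula is known at the subscripts \<open>lam 0\<close> and \<open>lam 1\<close>;
  \<psi> moves it to \<open>lam i\<close> and \<rho>. The hypothesis on \<open>q\<close> admits both
  \<open>lam i\<close> itself and the exceptional subscript of d, minus \<partial> minus \<rho>. As
  a sum of variables, \<rho> commutes with the products.\<close>

lemma ceval_chom_act:
  assumes f: "f \<in> CHom sA sM" and \<rho>: "\<rho> = (\<Sum>k\<in>S. lam k)"
    and q: "dsub (- (lam i + \<rho>)) q = lam i"
  shows "ceval sM (C.ev ((!) [q]) (act a f)) (lam i + \<rho>) (const b) =
    action (lam i) \<rho> a (const f) (const b)"
proof -
  define \<psi> where "\<psi> = (!) [lam i, \<rho>]"
  note F = const_CHom[OF f]
  have "ceval sM (C.ev ((!) [q]) (act a f)) (lam i + \<rho>) (const b) =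
      V.ev \<psi> (ceval sM (act a f) (lam 0 + lam 1) (const b))"
    by (rule ceval_ev[OF chom_act(1)[OF f]]) (simp_all add: q[simplified] \<psi>_def subst_simps)
  also have "\<dots> = V.ev \<psi> (action (lam 0) (lam 1) a (const f) (const b))"
    by (simp only: chom_act(2)[OF f])
  also have "\<dots> = action (lam i) \<rho> a (const f) (const b)"
  proof -
    have *: "V.ev \<psi> (bil sM lM (const a) (lam 0) (V.ev ((!) [lam 1]) (f b))) =
        bil sM lM (const a) (lam i) (V.ev ((!) [\<rho>]) (f b))"
    proof (rule ev_transfer[OF V.cd_module_axioms V.cd_module_axioms])
      show "V.ev \<psi> (bil sM lM (const a) (lam 0) (const v)) = bil sM lM (const a) (lam i) (const v)" for v
        unfolding L.bil_constants V.ev_ev by (rule V.ev_cong[OF L.op_lpolys]) (simp add: \<psi>_def)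
      show "bil sM lM (const a) (lam i) (lact sM \<rho> Q) = lact sM \<rho> (bil sM lM (const a) (lam i) Q)" for Q
        unfolding \<rho> by (rule commute_sum_lam[OF V.cd_module_axioms V.cd_module_axioms L.bil_additive(2) L.bil_lam_right])
    qed (simp_all add: L.bil_additive L.bil_lam_right \<psi>_def CHomD(3)[OF f] del: One_nat_def)
    have **: "V.ev \<psi> (bil sM rM (V.ev ((!) [lam 1]) (f a)) (lam 0 + lam 1) (const b)) =
        bil sM rM (V.ev ((!) [\<rho>]) (f a)) (lam i + \<rho>) (const b)"
    proof (rule ev_transfer[OF V.cd_module_axioms V.cd_module_axioms,
          where T = "\<lambda>P. bil sM rM P (lam 0 + lam 1) (const b)"
            and T' = "\<lambda>P. bil sM rM P (lam i + \<rho>) (const b)"])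
      show "V.ev \<psi> (bil sM rM (const v) (lam 0 + lam 1) (const b)) =
          bil sM rM (const v) (lam i + \<rho>) (const b)" for v
        unfolding R.bil_constants V.ev_ev
        by (rule V.ev_cong[OF R.op_lpolys]) (simp add: \<psi>_def subst_simps)
      show "bil sM rM (lact sM \<rho> Q) (lam i + \<rho>) (const b) =
          lact sM \<rho> (bil sM rM Q (lam i + \<rho>) (const b))" for Q
        unfolding \<rho> by (rule commute_sum_lam[OF V.cd_module_axioms V.cd_module_axioms
            R.bil_additive(1) R.bil_lam_left])
    qed (simp_all add: R.bil_additive R.bil_lam_left \<psi>_def CHomD(3)[OF f] del: One_nat_def)
    \<comment> \<open>Here the inner polynomial is the product of a and b, in \<lambda>, and the
      outer map is evaluation at \<mu>; so \<open>lam 0\<close> and \<open>lam i\<close> take the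
      places that \<open>lam 1\<close> and \<rho> had before.\<close>
    have ***: "V.ev \<psi> (ceval sM (const f) (lam 1) (U.ev ((!) [lam 0]) (prd a b))) =
        ceval sM (const f) \<rho> (U.ev ((!) [lam i]) (prd a b))"
    proof (rule ev_transfer[OF U.cd_module_axioms V.cd_module_axioms])
      show "V.ev \<psi> (ceval sM (const f) (lam 1) (const v)) = ceval sM (const f) \<rho> (const v)" for v
        unfolding ceval_const[OF f] V.ev_ev by (rule V.ev_cong[OF CHomD(3)[OF f]]) (simp add: \<psi>_def)
    qed (simp_all add: ceval_additive_right[OF F] ceval_lam_right[OF F] \<psi>_def P.op_lpolys del: One_nat_def)
    show ?thesis
      unfolding action_def V.ev_simps ceval_const[OF f] P.bil_constants by (simp only: * ** ***)
  qed
  finally show ?thesis .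
qed

lemma action_additive: "additive (\<lambda>G. action q \<rho> a G Q)"
  using additive.add[OF L.bil_additive(2)] additive.add[OF R.bil_additive(1)]
  by (simp add: action_def additive_def ceval_simps algebra_simps)

lemma ceval_monomial:
  "ceval sM (lact (chom_scale sM) (single \<beta> 1) G) \<rho> Q =
    lact sM (single \<beta> 1) (ceval sM G \<rho> (Q :: 'a lpoly))"
  unfolding ceval_def
  by (rule V.bil_monomial_left) (simp_all add: additive_def C.module_axioms)

lemma action_monomial:
  "action q \<rho> a (lact (chom_scale sM) (single \<beta> 1) G) Q = lact sM (single \<beta> 1) (action q \<rho> a G Q)"
proof -
  have "bil sM lM P q' (lact sM (single \<beta> 1) X) = lact sM (single \<beta> 1) (bil sM lM P q' X)"
    "bil sM rM (lact sM (single \<beta> 1) X) q' Y = lact sM (single \<beta> 1) (bil sM rM X q' Y)" for P q' X Y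
    by (rule V.bil_monomial_right V.bil_monomial_left; simp add: L.additive_right R.additive_left M.module_axioms)+
  then show ?thesis
    by (simp add: action_def ceval_monomial V.lact_simps)
qed

text \<open>Both sides split over the monomials of \<open>G\<close>, the left by the definition of
  \<open>bil\<close>, the right by additivity; monomials factor out and leave the constant
  case.\<close>

lemma ceval_bil_chom_act:
  assumes G: "G \<in> lpolys (CHom sA sM) n" and \<rho>: "\<rho> = (\<Sum>k\<in>S. lam k)"
    and q: "dsub (- (lam i + \<rho>)) q = lam i"
  shows "ceval sM (bil (chom_scale sM) act (const a) q G) (lam i + \<rho>) (const b) =
    action (lam i) \<rho> a G (const b)"
\<comment> \<open>At a = 0 the support of \<open>const a\<close> is empty and both sides are 0; the
  expansion below is for nonzero a.\<close>
proof (cases "a = 0")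
  case False
  have expand: "bil (chom_scale sM) act (const a) q G =
      (\<Sum>\<beta>\<in>keys G. lact (chom_scale sM) (single \<beta> 1) (C.ev ((!) [q]) (act a (coef G \<beta>))))"
    using False by (simp add: bil_def const_def C.lsubst_eq_ev)
  have "ceval sM (bil (chom_scale sM) act (const a) q G) (lam i + \<rho>) (const b) =
      (\<Sum>\<beta>\<in>keys G. action (lam i) \<rho> a (single \<beta> (coef G \<beta>)) (const b))"
    unfolding expand ceval_simps ceval_monomial
  proof (intro sum.cong refl)
    fix \<beta> assume "\<beta> \<in> keys G"
    have "single \<beta> (coef G \<beta>) = lact (chom_scale sM) (single \<beta> 1) (const (coef G \<beta>))"
      by (simp add: const_def)
    then show "lact sM (single \<beta> 1) (ceval sM (C.ev ((!) [q]) (act a (coef G \<beta>))) (lam i + \<rho>) (const b)) =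
        action (lam i) \<rho> a (single \<beta> (coef G \<beta>)) (const b)"
      by (simp only: action_monomial ceval_chom_act[OF coef_CHom[OF G] \<rho> q])
  qed
  also have "\<dots> = action (lam i) \<rho> a G (const b)"
    unfolding additive.sum[OF action_additive, symmetric] sum_monomials ..
  finally show ?thesis .
qed (simp add: action_def ceval_simps)

end

section \<open>Uncurrying commutes with the differentials\<close>

lemma omit_snoc: "omit I (xs @ [x]) = omit I xs @ (if length xs \<in> I then [] else [x])"
  by (simp add: omit_def nths_append)

lemma omit_map: "omit I (map f xs) = map f (omit I xs)"
  by (simp add: omit_def nths_map)

lemma set_omit: "set (omit I xs) \<subseteq> set xs"
  by (simp add: omit_def set_nths_subset)

lemma length_omit: "length (omit I xs) = card ({..<length xs} - I)"
proof -
  have "{..<length xs} - I = {i. i < length xs \<and> i \<in> - I}"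
    by auto
  then show ?thesis
    by (simp add: omit_def length_nths)
qed

lemma sum_list_omit: "sum_list (omit I xs) = (\<Sum>k\<in>{..<length xs} - I. xs ! k)"
  for xs :: "'r::comm_monoid_add list"
proof (induction xs rule: rev_induct)
  case (snoc x xs)
  have "(\<Sum>k\<in>{..<length xs} - I. (xs @ [x]) ! k) = (\<Sum>k\<in>{..<length xs} - I. xs ! k)"
    by (intro sum.cong) (auto simp: nth_append)
  moreover have "{..<Suc (length xs)} - I = (if length xs \<in> I then {..<length xs} - I
      else insert (length xs) ({..<length xs} - I))"
    by (auto simp: less_Suc_eq)
  ultimately show ?case
    using snoc by (simp add: omit_snoc add.commute)
qed (simp add: omit_def)

lemma omit_cong:
  assumes "I \<inter> {..<length xs} = J \<inter> {..<length xs}"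
  shows "omit I xs = omit J xs"
proof -
  have "i \<in> I \<longleftrightarrow> i \<in> J" if "i < length xs" for i
    using assms that by blast
  then have "filter (\<lambda>p. snd p \<in> - I) (zip xs [0..<length xs]) =
      filter (\<lambda>p. snd p \<in> - J) (zip xs [0..<length xs])"
    by (intro filter_cong refl) (auto dest!: set_zip_rightD)
  then show ?thesis
    by (simp add: omit_def nths_def)
qed

lemma omit_none:
  assumes "I \<inter> {..<length xs} = {}"
  shows "omit I xs = xs"
proof -
  have "omit I xs = omit {} xs"
    by (rule omit_cong) (simp add: assms)
  then show ?thesis
    by (simp add: omit_def nths_all)
qed

lemma length_lams [simp]: "length (lams n) = n"
  by (simp add: lams_def)

lemma nth_lams [simp]: "k < n \<Longrightarrow> lams n ! k = lam k"
  by (simp add: lams_def)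

lemma lams_Suc: "lams (Suc n) = lams n @ [lam n]"
  by (simp add: lams_def)

lemma set_lams: "set (lams n) = lam ` {..<n}"
  by (simp add: lams_def atLeast0LessThan)

lemma omit_lams_nth: "k < length (omit I (lams n)) \<Longrightarrow> omit I (lams n) ! k \<in> lam ` {..<n}"
  using nth_mem set_omit[of I "lams n"] set_lams by blast

lemma sum_list_omit_lams: "sum_list (omit I (lams n)) = (\<Sum>k\<in>{..<n} - I. lam k)"
  by (simp add: sum_list_omit)

lemma swap_append: "i < length xs \<Longrightarrow> j < length xs \<Longrightarrow> swap i j (xs @ ys) = swap i j xs @ ys"
  by (simp add: swap_def nth_append list_update_append)

lemma length_swap [simp]: "length (swap i j xs) = length xs"
  by (simp add: swap_def)

lemma mset_swap': "i < length xs \<Longrightarrow> j < length xs \<Longrightarrow> mset (swap i j xs) = mset xs"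
  by (simp add: swap_def mset_swap)

lemma sum_list_swap: "i < length xs \<Longrightarrow> j < length xs \<Longrightarrow> sum_list (swap i j xs) = sum_list xs"
  for xs :: "'r::comm_monoid_add list"
  by (metis mset_swap' sum_mset_sum_list)

lemma set_swap: "i < length xs \<Longrightarrow> j < length xs \<Longrightarrow> set (swap i j xs) = set xs"
  by (metis mset_swap' set_mset_mset)

lemma sum_list_lams: "sum_list (lams n) = (\<Sum>k<n. lam k)"
  by (induction n) (simp_all add: lams_Suc lams_def[of 0])

section \<open>Cochains at constant arguments, with at most one polynomial among them\<close>

lemma listset_empty: "{} \<in> set As \<Longrightarrow> listset As = {}"
  by (induction As) (auto simp: set_Cons_def)

lemma listset_consts:
  "0 \<notin> set xs \<Longrightarrow> listset (map Poly_Mapping.keys (map const xs)) = {replicate (length xs) 0}"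
  by (induction xs) (auto simp: set_Cons_def const_def)

lemma listset_insert:
  "0 \<notin> set xs \<Longrightarrow> 0 \<notin> set ys \<Longrightarrow>
    listset (map Poly_Mapping.keys (map const xs @ Q # map const ys)) =
      (\<lambda>\<beta>. replicate (length xs) 0 @ \<beta> # replicate (length ys) 0) ` keys Q"
proof (induction xs)
  case Nil
  show ?case
    using listset_consts[OF Nil(2)] by (auto simp: set_Cons_def)
next
  case (Cons x xs)
  then show ?case
    by (auto simp: set_Cons_def const_def)
qed

lemma map2_lookup_consts: "map2 Poly_Mapping.lookup (map const xs) (replicate (length xs) 0) = xs"
  by (induction xs) (auto simp: const_def)

context cd_module
begin

text \<open>A zero entry has empty support, which makes \<open>capp\<close> an empty sum, so
  \<gamma> must vanish there; for cochains this follows from linearity.\<close>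

lemma capp_consts:
  assumes "0 \<in> set xs \<Longrightarrow> \<gamma> xs = 0"
  shows "capp s \<gamma> qs (map const xs) = ev ((!) qs) (\<gamma> xs)"
proof (cases "0 \<in> set xs")
  case True
  then have "{} \<in> set (map Poly_Mapping.keys (map const xs))"
    by force
  from listset_empty[OF this] show ?thesis
    using assms[OF True] by (simp add: capp_def ev_simps)
next
  case False
  then show ?thesis
    unfolding capp_def listset_consts[OF False]
    by (simp add: map2_lookup_consts lsubst_eq_ev sum_list_replicate)
qed

text \<open>One polynomial slot is enough: each cochain term of the differentials has at most one
  nonconstant argument, a bracket or a product.\<close>

lemma capp_insert:
  assumes "\<And>x. 0 \<in> set xs \<union> set ys \<Longrightarrow> \<gamma> (xs @ x # ys) = 0"
  shows "capp s \<gamma> qs (map const xs @ Q # map const ys) =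
    (\<Sum>\<beta>\<in>keys Q. lact s (single \<beta> 1) (ev ((!) qs) (\<gamma> (xs @ coef Q \<beta> # ys))))"
proof (cases "0 \<in> set xs \<union> set ys")
  case True
  then have "{} \<in> set (map Poly_Mapping.keys (map const xs @ Q # map const ys))"
    by force
  from listset_empty[OF this] show ?thesis
    using assms[OF True] by (simp add: capp_def ev_simps lact_simps)
next
  case False
  then have *: "listset (map Poly_Mapping.keys (map const xs @ Q # map const ys)) =
      (\<lambda>\<beta>. replicate (length xs) 0 @ \<beta> # replicate (length ys) 0) ` keys Q"
    by (intro listset_insert) auto
  show ?thesis
    unfolding capp_def *
    by (subst sum.reindex)
      (auto simp: inj_on_def map2_lookup_consts lsubst_eq_ev sum_list_replicate zip_append intro!: sum.cong)
qed

end

text \<open>Only the shape of the values, without linearity or skew-symmetry: this already makes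
  \<open>uncurry\<close> injective, and it is easy to verify for the values of d.\<close>

definition (in chom_space) curried ::
    "nat \<Rightarrow> ('a list \<Rightarrow> ('a \<Rightarrow> 'm lpoly) lpoly) \<Rightarrow> bool" where
  "curried m \<gamma> \<longleftrightarrow> (\<forall>as. length as \<noteq> m \<longrightarrow> \<gamma> as = 0) \<and>
     (\<forall>as. length as = m \<longrightarrow> \<gamma> as \<in> lpolys (CHom sA sM) (m - 1))"

definition (in chom_space) uncurry ::
    "nat \<Rightarrow> ('a list \<Rightarrow> ('a \<Rightarrow> 'm lpoly) lpoly) \<Rightarrow> ('a list \<Rightarrow> 'm lpoly)" where
  "uncurry m \<gamma> as = (if length as = Suc m
     then ceval sM (\<gamma> (butlast as)) (\<Sum>k<m. lam k) (const (last as)) else 0)"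

context chom_space
begin

lemma curried_lpolys: "curried (Suc n) \<gamma> \<Longrightarrow> length as = Suc n \<Longrightarrow> \<gamma> as \<in> lpolys (CHom sA sM) n"
  by (simp add: curried_def)

lemma uncurry_snoc:
  "length as = m \<Longrightarrow> uncurry m \<gamma> (as @ [b]) = ceval sM (\<gamma> as) (\<Sum>k<m. lam k) (const b)"
  by (simp add: uncurry_def)

lemma uncurry_vanish:
  assumes "\<And>as. 0 \<in> set as \<Longrightarrow> \<gamma> as = 0" "0 \<in> set as"
  shows "uncurry m \<gamma> as = 0"
proof (cases "length as = Suc m")
  case True
  then obtain ys y where "as = ys @ [y]" "length ys = m"
    by (metis length_Suc_conv_rev)
  then show ?thesis
    using assms by (auto simp: uncurry_snoc ceval_simps)
qed (simp add: uncurry_def)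

lemma uncurry_additive: "additive (uncurry m)"
  by (auto simp: additive_def uncurry_def fun_eq_iff ceval_simps)

lemma uncurry_scale:
  "uncurry m (cochain_scale (chom_scale sM) c \<gamma>) = cochain_scale sM c (uncurry m \<gamma>)"
  by (auto simp: uncurry_def cochain_scale_def fun_eq_iff ceval_lact V.lact_simps)

lemma curried_add:
  assumes "curried m \<gamma>" "curried m \<gamma>'"
  shows "curried m (\<gamma> + \<gamma>')"
  using assms by (auto simp: curried_def intro!: C.lpolys_add subspace_CHom)

lemma uncurry_inject:
  assumes "curried (Suc n) \<gamma>" "curried (Suc n) \<gamma>'" "uncurry (Suc n) \<gamma> = uncurry (Suc n) \<gamma>'"
  shows "\<gamma> = \<gamma>'"
proof
  fix as
  show "\<gamma> as = \<gamma>' as"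
  proof (cases "length as = Suc n")
    case True
    show ?thesis
    proof (rule ceval_total_inject)
      show "ceval sM (\<gamma> as) (\<Sum>k<Suc n. lam k) (const b) =
          ceval sM (\<gamma>' as) (\<Sum>k<Suc n. lam k) (const b)" for b
        using fun_cong[OF assms(3), of "as @ [b]"] unfolding uncurry_snoc[OF True] .
    qed (use assms True in \<open>auto simp: curried_def\<close>)
  qed (use assms in \<open>auto simp: curried_def\<close>)
qed

text \<open>The last argument of \<gamma> has an implicit subscript, which uncurrying makes
  explicit: \<open>qs'\<close> has one entry more than \<gamma> has subscripts, and that entry is
  fixed by the total \<mu>. The others are those of \<gamma> with \<partial> replaced by
  -\<mu>.\<close>

lemma uncurry_ev:
  assumes \<gamma>: "curried (Suc n) \<gamma>" "length as = Suc n"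
    and qs: "length qs' = Suc n" "\<And>k. k < n \<Longrightarrow> dsub (- \<mu>) (qs ! k) = qs' ! k" "sum_list qs' = \<mu>"
  shows "ceval sM (C.ev ((!) qs) (\<gamma> as)) \<mu> (const b) =
    V.ev ((!) qs') (uncurry (Suc n) \<gamma> (as @ [b]))"
  unfolding uncurry_snoc[OF \<gamma>(2)]
proof (rule ceval_ev[OF curried_lpolys[OF \<gamma>]])
  show "subst ((!) qs') (\<Sum>k<Suc n. lam k) = \<mu>"
    unfolding subst_simps subst_lam
    using qs(1) by (simp add: sum_list_sum_nth atLeast0LessThan flip: qs(3))
qed (rule qs(2))

lemma curried_ev_lpolys:
  assumes "curried (Suc n) \<gamma>" "length as = Suc n" "\<And>k. k < n \<Longrightarrow> qs ! k \<in> lpolys UNIV m"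
  shows "C.ev ((!) qs) (\<gamma> as) \<in> lpolys (CHom sA sM) m"
  by (rule C.lpolys_ev[OF subspace_CHom curried_lpolys[OF assms(1,2)]]) (rule assms(3))

text \<open>For the bracket terms, whose polynomial argument stands first.\<close>

lemma ceval_capp_Cons:
  assumes \<gamma>: "curried (Suc n) \<gamma>" and vanish: "\<And>as. 0 \<in> set as \<Longrightarrow> \<gamma> as = 0"
    and len: "length ys = n"
    and qs: "length qs' = Suc n" "\<And>k. k < n \<Longrightarrow> dsub (- \<mu>) (qs ! k) = qs' ! k" "sum_list qs' = \<mu>"
  shows "ceval sM (capp (chom_scale sM) \<gamma> qs (Q # map const ys)) \<mu> (const b) =
    capp sM (uncurry (Suc n) \<gamma>) qs' (Q # map const ys @ [const b])"
proof -
  have "capp (chom_scale sM) \<gamma> qs (Q # map const ys) =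
      (\<Sum>\<beta>\<in>keys Q. lact (chom_scale sM) (single \<beta> 1) (C.ev ((!) qs) (\<gamma> (coef Q \<beta> # ys))))"
    using C.capp_insert[of "[]" ys \<gamma> qs Q] vanish by simp
  moreover have "capp sM (uncurry (Suc n) \<gamma>) qs' (Q # map const ys @ [const b]) =
      (\<Sum>\<beta>\<in>keys Q. lact sM (single \<beta> 1) (V.ev ((!) qs') (uncurry (Suc n) \<gamma> (coef Q \<beta> # ys @ [b]))))"
  proof -
    have "uncurry (Suc n) \<gamma> ([] @ x # ys @ [b]) = 0" if "0 \<in> set [] \<union> set (ys @ [b])" for x
      using that by (intro uncurry_vanish[OF vanish]) auto
    from V.capp_insert[of "[]" "ys @ [b]" "uncurry (Suc n) \<gamma>", OF this] show ?thesis by simp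
  qed
  moreover have "ceval sM (C.ev ((!) qs) (\<gamma> (x # ys))) \<mu> (const b) =
      V.ev ((!) qs') (uncurry (Suc n) \<gamma> (x # ys @ [b]))" for x
    using uncurry_ev[OF \<gamma> _ qs, of "x # ys" b] len by simp
  ultimately show ?thesis
    by (simp add: ceval_simps ceval_lact)
qed

text \<open>For the action terms: the polynomial is the argument of the conformal linear map, so the
  value of \<gamma> stays fixed while \<open>Q\<close> is expanded.\<close>

lemma ceval_capp_snoc:
  assumes \<gamma>: "curried (Suc n) \<gamma>" and vanish: "\<And>as. 0 \<in> set as \<Longrightarrow> \<gamma> as = 0"
    and len: "length ys = Suc n" and mem: "\<And>k. k < n \<Longrightarrow> qs ! k \<in> lpolys UNIV m"
    and qs: "length qs' = Suc n" "\<And>k. k < n \<Longrightarrow> dsub (- \<mu>) (qs ! k) = qs' ! k" "sum_list qs' = \<mu>"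
  shows "ceval sM (capp (chom_scale sM) \<gamma> qs (map const ys)) \<mu> Q =
    capp sM (uncurry (Suc n) \<gamma>) qs' (map const ys @ [Q])"
proof -
  have "capp (chom_scale sM) \<gamma> qs (map const ys) = C.ev ((!) qs) (\<gamma> ys)"
    by (rule C.capp_consts) (rule vanish)
  moreover have "capp sM (uncurry (Suc n) \<gamma>) qs' (map const ys @ [Q]) =
      (\<Sum>\<beta>\<in>keys Q. lact sM (single \<beta> 1) (V.ev ((!) qs') (uncurry (Suc n) \<gamma> (ys @ [coef Q \<beta>]))))"
  proof -
    have "uncurry (Suc n) \<gamma> (ys @ x # []) = 0" if "0 \<in> set ys \<union> set []" for x
      using that by (intro uncurry_vanish[OF vanish]) auto
    from V.capp_insert[of ys "[]" "uncurry (Suc n) \<gamma>", OF this] show ?thesis by simp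
  qed
  moreover have "ceval sM (C.ev ((!) qs) (\<gamma> ys)) \<mu> Q =
      (\<Sum>\<beta>\<in>keys Q. lact sM (single \<beta> 1) (V.ev ((!) qs') (uncurry (Suc n) \<gamma> (ys @ [coef Q \<beta>]))))"
  proof -
    have G: "C.ev ((!) qs) (\<gamma> ys) \<in> lpolys (CHom sA sM) m"
      by (rule curried_ev_lpolys[OF \<gamma> len mem])
    have "ceval sM (C.ev ((!) qs) (\<gamma> ys)) \<mu> (const b) =
        V.ev ((!) qs') (uncurry (Suc n) \<gamma> (ys @ [b]))" for b
      by (rule uncurry_ev[OF \<gamma> len qs])
    then show ?thesis
      by (subst ceval_expand_right[OF G]) (simp only:)
  qed
  ultimately show ?thesis by simp
qed

end

lemma length_Suc_snoc: "length xs = Suc m \<Longrightarrow> \<exists>ys y. xs = ys @ [y] \<and> length ys = m"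
  by (metis length_Suc_conv_rev)

context lsca_module
begin

abbreviation br :: "'a \<Rightarrow> 'a \<Rightarrow> 'a lpoly" where
  "br \<equiv> subadjacent sA prd"

lemma br_lpolys: "br a b \<in> lpolys UNIV 1"
  unfolding subadjacent_def U.lsubst_eq_ev
  by (intro U.lpolys_diff A.subspace_UNIV P.op_lpolys U.lpolys_ev[OF A.subspace_UNIV P.op_lpolys])
    (auto intro!: lpolys_scalar_intros)

text \<open>One summand of d in which an argument acts yields three of \<delta>, one for each term
  of the action formula. \<open>q\<close> and \<open>qs\<close> are left abstract to cover the
  regular summands and the exceptional one alike.\<close>

lemma uncurry_action_term:
  assumes \<gamma>: "curried (Suc n) \<gamma>" and vanish: "\<And>as. 0 \<in> set as \<Longrightarrow> \<gamma> as = 0"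
    and len: "length as = Suc (Suc n)" and i: "i < Suc (Suc n)"
    and q: "dsub (- (\<Sum>k<Suc (Suc n). lam k)) q = lam i"
    and qs: "\<And>k. k < n \<Longrightarrow> qs ! k = omit {i} (lams (Suc (Suc n))) ! k"
  defines "\<omega> \<equiv> uncurry (Suc n) \<gamma>" and "L \<equiv> omit {i} (lams (Suc (Suc n)))"
  shows "ceval sM (bil (chom_scale sM) act (const (as ! i)) q
      (capp (chom_scale sM) \<gamma> qs (map const (omit {i} as)))) (\<Sum>k<Suc (Suc n). lam k) (const b) =
    bil sM lM (const (as ! i)) (lam i) (capp sM \<omega> L (map const (omit {i} as) @ [const b]))
    + bil sM rM (capp sM \<omega> L (map const (omit {i} as) @ [const (as ! i)])) (\<Sum>k<Suc (Suc n). lam k) (const b)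
    - capp sM \<omega> L (map const (omit {i} as) @ [bil sA prd (const (as ! i)) (lam i) (const b)])"
proof -
  \<comment> \<open>The total splits as in the action formula: \<open>lam i\<close> for the acting
    argument, \<rho> for the inner evaluation.\<close>
  define \<rho> where "\<rho> = (\<Sum>k\<in>{..<Suc (Suc n)} - {i}. lam k)"
  have \<mu>: "(\<Sum>k<Suc (Suc n). lam k) = lam i + \<rho>"
    unfolding \<rho>_def using i by (intro sum.remove) auto
  have lenL: "length L = Suc n" and len_omit: "length (omit {i} as) = Suc n"
    using i len by (simp_all add: L_def length_omit)
  have L: "L ! k \<in> lam ` {..<Suc (Suc n)}" if "k < Suc n" for k
    using that lenL omit_lams_nth[of k "{i}" "Suc (Suc n)"] by (simp add: L_def)
  have qsL: "qs ! k = L ! k" if "k < n" for k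
    using qs[OF that] by (simp add: L_def)
  have mem: "qs ! k \<in> lpolys UNIV (Suc (Suc n))" if "k < n" for k
    using L[of k] qsL[OF that] that by (auto intro!: lpolys_lam)
  \<comment> \<open>The entries are variables, so replacing \<partial> does nothing.\<close>
  have ds: "dsub (- \<rho>) (qs ! k) = L ! k" if "k < n" for k
    using L[of k] qsL[OF that] that by auto
  have sumL: "sum_list L = \<rho>"
    unfolding L_def \<rho>_def by (rule sum_list_omit_lams)
  have snoc: "ceval sM (capp (chom_scale sM) \<gamma> qs (map const (omit {i} as))) \<rho> Q =
      capp sM \<omega> L (map const (omit {i} as) @ [Q])" for Q
    unfolding \<omega>_def by (rule ceval_capp_snoc[OF \<gamma> vanish len_omit mem lenL ds sumL])
  have G: "capp (chom_scale sM) \<gamma> qs (map const (omit {i} as)) \<in> lpolys (CHom sA sM) (Suc (Suc n))"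
  proof -
    have "capp (chom_scale sM) \<gamma> qs (map const (omit {i} as)) = C.ev ((!) qs) (\<gamma> (omit {i} as))"
      by (rule C.capp_consts) (rule vanish)
    then show ?thesis
      using curried_ev_lpolys[OF \<gamma> len_omit mem] by simp
  qed
  have "ceval sM (bil (chom_scale sM) act (const (as ! i)) q
      (capp (chom_scale sM) \<gamma> qs (map const (omit {i} as)))) (lam i + \<rho>) (const b) =
    action (lam i) \<rho> (as ! i) (capp (chom_scale sM) \<gamma> qs (map const (omit {i} as))) (const b)"
    by (rule ceval_bil_chom_act[OF G \<rho>_def]) (rule q[unfolded \<mu>])
  then show ?thesis
    unfolding action_def \<mu> snoc .
qed

lemma uncurry_d:
  assumes \<gamma>: "curried (Suc n) \<gamma>" and vanish: "\<And>as. 0 \<in> set as \<Longrightarrow> \<gamma> as = 0"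
  shows "uncurry (Suc (Suc n)) (d_lie sA br (chom_scale sM) act (Suc n) \<gamma>) =
    d_lsca sA prd sM lM rM (Suc (Suc n)) (uncurry (Suc n) \<gamma>)"
proof
  fix xs
  define m where "m = Suc n"
  show "uncurry (Suc (Suc n)) (d_lie sA br (chom_scale sM) act (Suc n) \<gamma>) xs =
    d_lsca sA prd sM lM rM (Suc (Suc n)) (uncurry (Suc n) \<gamma>) xs"
  proof (cases "length xs = Suc (Suc m)")
    case True
    obtain as b where xs: "xs = as @ [b]" and as: "length as = Suc m"
      using length_Suc_snoc[OF True] by auto
    obtain cs c where cs: "as = cs @ [c]" "length cs = m"
      using length_Suc_snoc[OF as] by auto
    define \<mu> where "\<mu> = (\<Sum>k<Suc m. lam k)"
    define \<omega> where "\<omega> = uncurry m \<gamma>"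
    define L where "L i = omit {i} (lams (Suc m))" for i
    \<comment> \<open>\<open>X\<close>, \<open>Y\<close>, \<open>Z\<close> are the terms of the
      first three sums of \<delta> at index i, and \<open>B\<close> its bracket terms, in the order
      of \<open>d_lsca\<close>.\<close>
    define X where "X i = bil sM lM (const (as ! i)) (lam i) (capp sM \<omega> (L i) (map const (omit {i} as) @ [const b]))" for i
    define Y where "Y i = bil sM rM (capp sM \<omega> (L i) (map const (omit {i} as) @ [const (as ! i)])) \<mu> (const b)" for i
    define Z where "Z i = capp sM \<omega> (L i) (map const (omit {i} as) @ [bil sA prd (const (as ! i)) (lam i) (const b)])" for i
    define B where "B i j = capp sM \<omega> ((lam i + lam j) # omit {i, j} (lams (Suc m)))
      (bil sA br (const (as ! i)) (lam i) (const (as ! j)) # map const (omit {i, j} as) @ [const b])" for i j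
    have act_i: "ceval sM (bil (chom_scale sM) act (const (as ! i)) (lam i)
        (capp (chom_scale sM) \<gamma> (omit {i} (lams m)) (map const (omit {i} as)))) \<mu> (const b) =
        X i + Y i - Z i" if "i < m" for i
      unfolding X_def Y_def Z_def L_def \<omega>_def m_def \<mu>_def
    proof (rule uncurry_action_term[OF \<gamma> vanish])
      show "omit {i} (lams (Suc n)) ! k = omit {i} (lams (Suc (Suc n))) ! k" if "k < n" for k
        using \<open>i < m\<close> that
        by (simp add: lams_Suc[of "Suc n"] omit_snoc nth_append length_omit m_def)
    qed (use that as in \<open>simp_all add: m_def\<close>)
    have act_m: "ceval sM (bil (chom_scale sM) act (const (as ! m)) (- del - (\<Sum>k<m. lam k))
        (capp (chom_scale sM) \<gamma> (lams (m - 1)) (map const (omit {m} as)))) \<mu> (const b) =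
        X m + Y m - Z m"
      unfolding X_def Y_def Z_def L_def \<omega>_def m_def \<mu>_def
    proof (rule uncurry_action_term[OF \<gamma> vanish])
      show "lams (Suc n - 1) ! k = omit {Suc n} (lams (Suc (Suc n))) ! k" if "k < n" for k
        using that by (simp add: lams_Suc[of "Suc n"] omit_snoc omit_none)
    qed (use as in \<open>simp_all add: m_def dsub_simps\<close>)
    have br_ij: "ceval sM (capp (chom_scale sM) \<gamma> ((lam i + lam j) # omit {i, j} (lams m))
        (bil sA br (const (as ! i)) (lam i) (const (as ! j)) # map const (omit {i, j} as))) \<mu> (const b) =
        B i j" if "i < j" "j < m" for i j
      unfolding B_def \<omega>_def m_def
    proof (rule ceval_capp_Cons[OF \<gamma> vanish])
      have *: "card ({..<Suc n} - {i, j}) = n - 1" "0 < n"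
        using that by (auto simp: m_def card_Diff_subset)
      show "length (omit {i, j} as) = n" "length ((lam i + lam j) # omit {i, j} (lams (Suc (Suc n)))) = Suc n"
        using that as by (simp_all add: length_omit m_def card_Diff_subset)
      show "sum_list ((lam i + lam j) # omit {i, j} (lams (Suc (Suc n)))) = \<mu>"
        using that unfolding sum_list.Cons sum_list_omit_lams \<mu>_def m_def
        by (subst sum.remove[of _ i], simp, simp, subst sum.remove[of _ j])
          (auto simp: insert_commute Diff_insert2[symmetric] add.assoc)
      show "dsub (- \<mu>) (((lam i + lam j) # omit {i, j} (lams (Suc n))) ! k) =
          ((lam i + lam j) # omit {i, j} (lams (Suc (Suc n)))) ! k" if "k < n" for k
        using that \<open>i < j\<close> \<open>j < m\<close> * omit_lams_nth[of "k - 1" "{i, j}" "Suc n"]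
        by (auto simp: nth_Cons dsub_simps lams_Suc[of "Suc n"] omit_snoc nth_append length_omit
            split: nat.split)
    qed
    \<comment> \<open>With \<partial> replaced by -\<mu>, the first subscript becomes \<mu> minus
      the variables k < m with k \<noteq> i, that is \<open>lam i + lam m\<close>: the subscript
      that \<delta> has for the pair (i, m).\<close>
    have br_im: "ceval sM (capp (chom_scale sM) \<gamma>
          (butlast ((- del - (\<Sum>k\<in>{..<m} - {i}. lam k)) # omit {i} (lams m)))
        (bil sA br (const (as ! i)) (lam i) (const (as ! m)) # map const (omit {i, m} as))) \<mu> (const b) =
        B i m" if "i < m" for i
      unfolding B_def \<omega>_def m_def
    proof (rule ceval_capp_Cons[OF \<gamma> vanish])
      have *: "card ({..<Suc n} - {i}) = n"
        using that by (auto simp: m_def)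
      have **: "omit {i, Suc n} (lams (Suc (Suc n))) = omit {i} (lams (Suc n))"
        by (auto simp: lams_Suc[of "Suc n"] omit_snoc intro!: omit_cong)
      have \<mu>: "\<mu> = lam i + lam m + (\<Sum>k\<in>{..<m} - {i}. lam k)"
        unfolding \<mu>_def using that by (simp add: sum.remove[of _ i] add_ac)
      show "length (omit {i, Suc n} as) = n"
        using that as by (simp add: length_omit m_def card_Diff_subset)
      show "length ((lam i + lam (Suc n)) # omit {i, Suc n} (lams (Suc (Suc n)))) = Suc n"
        unfolding ** using * by (simp add: length_omit)
      show "sum_list ((lam i + lam (Suc n)) # omit {i, Suc n} (lams (Suc (Suc n)))) = \<mu>"
        unfolding ** sum_list.Cons sum_list_omit_lams \<mu> by (simp add: m_def)
      show "dsub (- \<mu>) (butlast ((- del - (\<Sum>k\<in>{..<Suc n} - {i}. lam k)) # omit {i} (lams (Suc n))) ! k) =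
          ((lam i + lam (Suc n)) # omit {i, Suc n} (lams (Suc (Suc n)))) ! k" if "k < n" for k
      proof -
        have "butlast ((- del - (\<Sum>k\<in>{..<Suc n} - {i}. lam k)) # omit {i} (lams (Suc n))) ! k =
            ((- del - (\<Sum>k\<in>{..<Suc n} - {i}. lam k)) # omit {i} (lams (Suc n))) ! k"
          using that * by (intro nth_butlast) (simp add: length_omit del: butlast.simps)
        then show ?thesis
          unfolding ** using that * omit_lams_nth[of "k - 1" "{i}" "Suc n"]
          by (auto simp: nth_Cons dsub_simps length_omit \<mu> m_def simp del: butlast.simps split: nat.split)
      qed
    qed
    have "uncurry (Suc m) (d_lie sA br (chom_scale sM) act m \<gamma>) xs =
        ceval sM (d_lie sA br (chom_scale sM) act m \<gamma> as) \<mu> (const b)"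
      unfolding xs \<mu>_def by (rule uncurry_snoc[OF as])
    also have "\<dots> = (\<Sum>i<m. lact sM ((-1) ^ i) (X i + Y i - Z i)) + lact sM ((-1) ^ m) (X m + Y m - Z m)
        + (\<Sum>j<m. \<Sum>i<j. lact sM ((-1) ^ (i + j)) (B i j)) + (\<Sum>i<m. lact sM ((-1) ^ (i + m)) (B i m))"
      unfolding d_lie_def Let_def
      using as
      by (simp add: ceval_simps ceval_lact dsub_simps omit_map act_i act_m[simplified] br_ij br_im
          del: butlast.simps cong: sum.cong_simp)
    \<comment> \<open>The signs \<open>(-1) ^ m\<close> and \<open>(-1) ^ (i + m)\<close> are those
      of \<delta> at index m and at the pair (i, m), so the exceptional terms extend the ranges from
      m to m + 1.\<close>
    also have "\<dots> = (\<Sum>i<Suc m. lact sM ((-1) ^ i) (X i)) + (\<Sum>i<Suc m. lact sM ((-1) ^ i) (Y i))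
        - (\<Sum>i<Suc m. lact sM ((-1) ^ i) (Z i)) + (\<Sum>j<Suc m. \<Sum>i<j. lact sM ((-1) ^ (i + j)) (B i j))"
      by (simp add: V.lact_simps sum.distrib sum_subtractf algebra_simps)
    also have "\<dots> = d_lsca sA prd sM lM rM (Suc m) (uncurry m \<gamma>) xs"
    proof -
      have a1: "xs ! i = as ! i" if "i < Suc m" for i
        using that as by (simp add: xs nth_append)
      have a2: "xs ! Suc m = b"
        using as by (simp add: xs nth_append)
      have a3: "omit {i} (map const xs) = map const (omit {i} as) @ [const b]" if "i < Suc m" for i
        using that as by (simp add: xs omit_map omit_snoc)
      have a4: "omit {i, Suc m} (map const xs) = map const (omit {i} as)" if "i < Suc m" for i
        using that as by (auto simp: xs omit_map omit_snoc intro!: arg_cong[where f = "map const"] omit_cong)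
      have a5: "omit {i, j} (map const xs) = map const (omit {i, j} as) @ [const b]"
        if "i < Suc m" "j < Suc m" for i j
        using that as by (simp add: xs omit_map omit_snoc)
      show ?thesis
        unfolding d_lsca_def Let_def X_def Y_def Z_def B_def L_def \<omega>_def \<mu>_def
        using True by (simp add: a1 a2 a3 a4 a5 del: sum.lessThan_Suc cong: sum.cong_simp)
    qed
    finally show ?thesis
      by (simp only: m_def)
  qed (simp add: uncurry_def d_lsca_def m_def)
qed

end

section \<open>Uncurrying as a bijection of cochains\<close>

text \<open>Linearity in the slot that holds 0. This supplies the hypothesis \<open>vanish\<close>
  of the lemmas on \<open>capp\<close> and d.\<close>

lemma cochain_vanish:
  assumes "\<gamma> \<in> cochains sR sV V m" "0 \<in> set as"
  shows "\<gamma> as = 0"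
proof (cases "length as = m")
  case True
  obtain i where i: "i < m" "as ! i = 0"
    using assms(2) True by (auto simp: in_set_conv_nth)
  have "C_linear sR sV (\<lambda>x. \<gamma> (as[i := x]))"
    using assms(1) True i(1) by (auto simp: cochains_def)
  then have "\<gamma> (as[i := 0 + 0]) = \<gamma> (as[i := 0]) + \<gamma> (as[i := 0])"
    unfolding C_linear_def by blast
  then show ?thesis
    using i by (metis add.right_neutral add_left_cancel list_update_id)
qed (use assms(1) in \<open>auto simp: cochains_def\<close>)

context cd_module
begin

lemma capp_Cons_lpolys:
  assumes V: "subspace V" and Q: "Q \<in> lpolys UNIV m"
    and \<gamma>: "\<And>x. \<gamma> (x # ys) \<in> lpolys V n" and vanish: "\<And>as. 0 \<in> set as \<Longrightarrow> \<gamma> as = 0"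
    and qs: "\<And>k. k < n \<Longrightarrow> qs ! k \<in> lpolys UNIV m"
  shows "capp s \<gamma> qs (Q # map const ys) \<in> lpolys V m"
proof -
  have "\<gamma> ([] @ x # ys) = 0" if "0 \<in> set [] \<union> set ys" for x
    using that by (intro vanish) auto
  from capp_insert[of "[]" ys \<gamma>, OF this]
  have "capp s \<gamma> qs (Q # map const ys) =
      (\<Sum>\<beta>\<in>keys Q. lact s (single \<beta> 1) (ev ((!) qs) (\<gamma> (coef Q \<beta> # ys))))"
    by simp
  moreover have "single \<beta> 1 \<in> lpolys UNIV m" if "\<beta> \<in> keys Q" for \<beta>
    using lpolysD(1)[OF Q that] by (intro lpolys_single) auto
  ultimately show ?thesis
    using qs by (auto intro!: lpolys_sum[OF V] lpolys_lact[OF V] lpolys_ev[OF V \<gamma>])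
qed

lemma capp_consts_lpolys:
  assumes V: "subspace V" and \<gamma>: "\<gamma> xs \<in> lpolys V n" and vanish: "\<And>as. 0 \<in> set as \<Longrightarrow> \<gamma> as = 0"
    and qs: "\<And>k. k < n \<Longrightarrow> qs ! k \<in> lpolys UNIV m"
  shows "capp s \<gamma> qs (map const xs) \<in> lpolys V m"
proof -
  have "capp s \<gamma> qs (map const xs) = ev ((!) qs) (\<gamma> xs)"
    by (rule capp_consts) (rule vanish)
  then show ?thesis
    using lpolys_ev[OF V \<gamma> qs] by simp
qed

end

lemma omit_lams_lpolys: "k < card ({..<n} - I) \<Longrightarrow> n \<le> m \<Longrightarrow> omit I (lams n) ! k \<in> lpolys UNIV m"
  using omit_lams_nth[of k I n] by (auto simp: length_omit intro!: lpolys_lam)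

context lsca_module
begin

text \<open>A count of variables, term by term. It places the values of d where
  \<open>uncurry\<close> is known to be injective.\<close>

lemma curried_d:
  assumes \<gamma>: "curried (Suc n) \<gamma>" and vanish: "\<And>as. 0 \<in> set as \<Longrightarrow> \<gamma> as = 0"
  shows "curried (Suc (Suc n)) (d_lie sA br (chom_scale sM) act (Suc n) \<gamma>)"
  unfolding curried_def
proof (intro conjI allI impI)
  fix as :: "'a list"
  define m where "m = Suc n"
  assume "length as = Suc (Suc n)"
  then have as: "length as = Suc m" by (simp add: m_def)
  have sign: "((-1) ^ k :: scalars) \<in> lpolys UNIV (Suc n)" for k
    by (intro lpolys_scalar_intros)
  have bil: "bil (chom_scale sM) act (const x) q (capp (chom_scale sM) \<gamma> qs (map const ys)) \<in>
      lpolys (CHom sA sM) m"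
    if "q \<in> lpolys UNIV m" "length ys = m" "\<And>k. k < n \<Longrightarrow> qs ! k \<in> lpolys UNIV m" for x q qs ys
    using that
    by (intro C.bil_lpolys[where X = UNIV and Y = "CHom sA sM"] subspace_CHom lpolys_const
        C.capp_consts_lpolys[where n = n] vanish curried_lpolys[OF \<gamma>] chom_act(1))
      (auto simp: m_def)
  have bracket: "capp (chom_scale sM) \<gamma> qs
      (bil sA br (const x) (lam i) (const y) # map const ys) \<in> lpolys (CHom sA sM) m"
    if "i < m" "length ys = n" "\<And>k. k < n \<Longrightarrow> qs ! k \<in> lpolys UNIV m" for x y i qs ys
    using that
    by (intro C.capp_Cons_lpolys[where n = n] subspace_CHom vanish curried_lpolys[OF \<gamma>]
        U.bil_lpolys[where X = UNIV and Y = UNIV] A.subspace_UNIV lpolys_const br_lpolys lpolys_lam)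
      (auto simp: m_def)
  show "d_lie sA br (chom_scale sM) act (Suc n) \<gamma> as \<in> lpolys (CHom sA sM) (Suc (Suc n) - 1)"
  proof -
    have 1: "bil (chom_scale sM) act (const (as ! i)) (lam i)
        (capp (chom_scale sM) \<gamma> (omit {i} (lams m)) (map const (omit {i} as))) \<in> lpolys (CHom sA sM) m"
      if "i < m" for i
      using that as by (intro bil lpolys_lam omit_lams_lpolys) (simp_all add: length_omit m_def)
    have 2: "bil (chom_scale sM) act (const (as ! m)) (- del - (\<Sum>k<m. lam k))
        (capp (chom_scale sM) \<gamma> (lams (m - 1)) (map const (omit {m} as))) \<in> lpolys (CHom sA sM) m"
      using as by (intro bil) (auto simp: length_omit m_def intro!: lpolys_scalar_intros)
    have 3: "capp (chom_scale sM) \<gamma> ((lam i + lam j) # omit {i, j} (lams m))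
        (bil sA br (const (as ! i)) (lam i) (const (as ! j)) # map const (omit {i, j} as))
        \<in> lpolys (CHom sA sM) m" if "i < j" "j < m" for i j
    proof (rule bracket)
      show "((lam i + lam j) # omit {i, j} (lams m)) ! k \<in> lpolys UNIV m" if "k < n" for k
      proof (cases k)
        case (Suc l)
        then show ?thesis
          using that \<open>i < j\<close> \<open>j < m\<close> omit_lams_lpolys[of l m "{i, j}" m]
          by (simp add: m_def card_Diff_subset)
      qed (use \<open>i < j\<close> \<open>j < m\<close> in \<open>auto intro!: lpolys_scalar_intros\<close>)
    qed (use that as in \<open>simp_all add: length_omit m_def card_Diff_subset\<close>)
    have 4: "capp (chom_scale sM) \<gamma> (butlast ((- del - (\<Sum>k\<in>{..<m} - {i}. lam k)) # omit {i} (lams m)))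
        (bil sA br (const (as ! i)) (lam i) (const (as ! m)) # map const (omit {i, m} as))
        \<in> lpolys (CHom sA sM) m" if "i < m" for i
    proof (rule bracket)
      show "butlast ((- del - (\<Sum>k\<in>{..<m} - {i}. lam k)) # omit {i} (lams m)) ! k \<in> lpolys UNIV m"
        if "k < n" for k
      proof -
        have *: "card ({..<m} - {i}) = n"
          using \<open>i < m\<close> by (simp add: m_def)
        then have "butlast ((- del - (\<Sum>k\<in>{..<m} - {i}. lam k)) # omit {i} (lams m)) ! k =
            ((- del - (\<Sum>k\<in>{..<m} - {i}. lam k)) # omit {i} (lams m)) ! k"
          using that by (intro nth_butlast) (simp add: length_omit del: butlast.simps)
        also have "\<dots> \<in> lpolys UNIV m"
        proof (cases k)
          case (Suc l)
          then show ?thesis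
            using that * omit_lams_lpolys[of l m "{i}" m] by simp
        qed (auto intro!: lpolys_scalar_intros)
        finally show ?thesis .
      qed
    qed (use that as in \<open>simp_all add: length_omit m_def card_Diff_subset\<close>)
    have "d_lie sA br (chom_scale sM) act m \<gamma> as \<in> lpolys (CHom sA sM) m"
      unfolding d_lie_def Let_def
      using as 2
      by (auto simp: omit_map m_def[symmetric] simp del: butlast.simps
          intro!: C.lpolys_add C.lpolys_sum subspace_CHom C.lpolys_lact sign[folded m_def] 1 3 4)
    then show ?thesis
      by (simp add: m_def)
  qed
qed (simp add: d_lie_def)

end

context chom_space
begin

lemma cochain_curried: "\<gamma> \<in> cochains sA (chom_scale sM) (CHom sA sM) m \<Longrightarrow> curried m \<gamma>"
  by (auto simp: cochains_def curried_def)

text \<open>Turns equations between values of \<gamma> into equations for the uncurried cochain, so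
  that cochain conditions transfer as equivalences.\<close>

lemma eq_iff_ceval:
  assumes "F \<in> lpolys (CHom sA sM) n" "G \<in> lpolys (CHom sA sM) n"
  shows "F = G \<longleftrightarrow> (\<forall>b. ceval sM F (\<Sum>k<Suc n. lam k) (const b) =
    ceval sM G (\<Sum>k<Suc n. lam k) (const b))"
  using ceval_total_inject[OF assms] by auto

context
  fixes n :: nat and \<gamma> :: "'a list \<Rightarrow> ('a \<Rightarrow> 'm lpoly) lpoly" and cs :: "'a list"
  assumes \<gamma>: "curried (Suc n) \<gamma>" and cs: "length cs = Suc n"
begin

lemma linear_iff_uncurry:
  "C_linear sA (chom_scale sM) (\<lambda>x. \<gamma> (cs[i := x])) \<longleftrightarrow>
    (\<forall>b. C_linear sA sM (\<lambda>x. uncurry (Suc n) \<gamma> (cs[i := x] @ [b])))"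
proof -
  have mem: "\<gamma> (cs[i := x]) \<in> lpolys (CHom sA sM) n" for x
    by (rule curried_lpolys[OF \<gamma>]) (simp add: cs)
  have mem': "lact (chom_scale sM) (const [:c:]) (\<gamma> (cs[i := x])) \<in> lpolys (CHom sA sM) n" for c x
    by (intro C.lpolys_lact subspace_CHom mem lpolys_const UNIV_I)
  show ?thesis
    unfolding C_linear_def eq_iff_ceval[OF mem C.lpolys_add[OF subspace_CHom mem mem]]
      eq_iff_ceval[OF mem mem']
    by (auto simp: uncurry_snoc cs ceval_simps ceval_lact simp del: sum.lessThan_Suc)
qed

lemma derivation_iff_uncurry:
  assumes "p \<in> lpolys UNIV n"
  shows "\<gamma> (cs[i := x]) = lact (chom_scale sM) p (\<gamma> cs) \<longleftrightarrow>
    (\<forall>b. uncurry (Suc n) \<gamma> (cs[i := x] @ [b]) =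
      lact sM (dsub (- (\<Sum>k<Suc n. lam k)) p) (uncurry (Suc n) \<gamma> (cs @ [b])))"
proof -
  have mem: "\<gamma> (cs[i := x]) \<in> lpolys (CHom sA sM) n" "\<gamma> cs \<in> lpolys (CHom sA sM) n"
    by (rule curried_lpolys[OF \<gamma>]; simp add: cs)+
  show ?thesis
    unfolding eq_iff_ceval[OF mem(1) C.lpolys_lact[OF subspace_CHom assms mem(2)]]
    by (simp add: uncurry_snoc cs ceval_lact del: sum.lessThan_Suc)
qed

lemma skew_iff_uncurry:
  assumes qs: "\<And>k. k < n \<Longrightarrow> qs ! k \<in> lpolys UNIV n"
    "length qs' = Suc n" "\<And>k. k < n \<Longrightarrow> dsub (- (\<Sum>k<Suc n. lam k)) (qs ! k) = qs' ! k"
    "sum_list qs' = (\<Sum>k<Suc n. lam k)"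
    and ds: "length ds = Suc n"
  shows "lsubst (chom_scale sM) qs (\<gamma> ds) = - \<gamma> cs \<longleftrightarrow>
    (\<forall>b. lsubst sM qs' (uncurry (Suc n) \<gamma> (ds @ [b])) = - uncurry (Suc n) \<gamma> (cs @ [b]))"
proof -
  have mem: "C.ev ((!) qs) (\<gamma> ds) \<in> lpolys (CHom sA sM) n" "- \<gamma> cs \<in> lpolys (CHom sA sM) n"
    by (rule curried_ev_lpolys[OF \<gamma> ds qs(1)], assumption)
      (intro C.lpolys_uminus subspace_CHom curried_lpolys[OF \<gamma> cs])
  have "ceval sM (C.ev ((!) qs) (\<gamma> ds)) (\<Sum>k<Suc n. lam k) (const b) =
      V.ev ((!) qs') (uncurry (Suc n) \<gamma> (ds @ [b]))" for b
    by (rule uncurry_ev[OF \<gamma> ds qs(2-4)])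
  then show ?thesis
    unfolding C.lsubst_eq_ev V.lsubst_eq_ev eq_iff_ceval[OF mem]
    by (simp add: uncurry_snoc cs ceval_simps del: sum.lessThan_Suc)
qed

text \<open>The conditions on the added slot are those that define CHom, extended to polynomials and
  read at the total subscript.\<close>

lemma uncurry_last:
  shows "uncurry (Suc n) \<gamma> (cs @ [b]) \<in> lpolys UNIV (Suc n)"
    and "C_linear sA sM (\<lambda>x. uncurry (Suc n) \<gamma> (cs @ [x]))"
    and "uncurry (Suc n) \<gamma> (cs @ [sA D b]) =
      lact sM (del + (\<Sum>k<Suc n. lam k)) (uncurry (Suc n) \<gamma> (cs @ [b]))"
proof -
  note F = curried_lpolys[OF \<gamma> cs]
  show "uncurry (Suc n) \<gamma> (cs @ [b]) \<in> lpolys UNIV (Suc n)"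
    unfolding uncurry_snoc[OF cs]
    by (intro ceval_lpolys[OF lpolys_mono[OF F]] lpolys_scalar_intros) auto
  show "C_linear sA sM (\<lambda>x. uncurry (Suc n) \<gamma> (cs @ [x]))"
    unfolding uncurry_snoc[OF cs] C_linear_def const_add U.const_scale
    by (simp add: additive.add[OF ceval_additive_right[OF F]] ceval_scalar_right[OF F])
  show "uncurry (Suc n) \<gamma> (cs @ [sA D b]) =
      lact sM (del + (\<Sum>k<Suc n. lam k)) (uncurry (Suc n) \<gamma> (cs @ [b]))"
    unfolding uncurry_snoc[OF cs] U.const_scale del_def[symmetric] by (rule ceval_del_right[OF F])
qed

lemma derivation_iff_uncurry_inner:
  assumes "i < n"
  shows "\<gamma> (cs[i := sA D (cs ! i)]) = lact (chom_scale sM) (- lam i) (\<gamma> cs) \<longleftrightarrow>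
    (\<forall>b. uncurry (Suc n) \<gamma> (cs[i := sA D (cs ! i)] @ [b]) =
      lact sM (- lam i) (uncurry (Suc n) \<gamma> (cs @ [b])))"
  using assms by (subst derivation_iff_uncurry) (simp_all add: dsub_simps lpolys_scalar_intros)

text \<open>At the total subscript, \<partial> plus the first n variables becomes
  \<open>- lam n\<close>: the rule of the distinguished slot of \<gamma> turns into that of an
  ordinary one.\<close>

lemma derivation_iff_uncurry_last:
  "\<gamma> (cs[n := sA D (cs ! n)]) = lact (chom_scale sM) (del + (\<Sum>k<n. lam k)) (\<gamma> cs) \<longleftrightarrow>
    (\<forall>b. uncurry (Suc n) \<gamma> (cs[n := sA D (cs ! n)] @ [b]) =
      lact sM (- lam n) (uncurry (Suc n) \<gamma> (cs @ [b])))"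
  by (subst derivation_iff_uncurry) (auto simp: dsub_simps intro!: lpolys_scalar_intros)

lemma skew_iff_uncurry_inner:
  assumes "i < j" "j < n"
  shows "lsubst (chom_scale sM) (swap i j (lams n)) (\<gamma> (swap i j cs)) = - \<gamma> cs \<longleftrightarrow>
    (\<forall>b. lsubst sM (swap i j (lams (Suc n))) (uncurry (Suc n) \<gamma> (swap i j cs @ [b])) =
      - uncurry (Suc n) \<gamma> (cs @ [b]))"
proof (rule skew_iff_uncurry)
  have lam: "swap i j (lams n) ! k \<in> lam ` {..<n}" if "k < n" for k
    using nth_mem[of k "swap i j (lams n)"] assms that by (simp add: set_swap set_lams)
  show "swap i j (lams n) ! k \<in> lpolys UNIV n" if "k < n" for k
    using lam[OF that] by (auto intro!: lpolys_lam)
  show "dsub (- (\<Sum>k<Suc n. lam k)) (swap i j (lams n) ! k) = swap i j (lams (Suc n)) ! k"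
    if "k < n" for k
    using lam[OF that] assms that by (auto simp: lams_Suc swap_append nth_append)
qed (use assms cs in \<open>simp_all add: sum_list_swap sum_list_lams\<close>)

lemma skew_iff_uncurry_last:
  assumes "i < n"
  shows "\<gamma> cs = - lsubst (chom_scale sM) ((lams n)[i := - del - (\<Sum>k<n. lam k)]) (\<gamma> (swap i n cs)) \<longleftrightarrow>
    (\<forall>b. lsubst sM (swap i n (lams (Suc n))) (uncurry (Suc n) \<gamma> (swap i n cs @ [b])) =
      - uncurry (Suc n) \<gamma> (cs @ [b]))"
proof -
  have "lsubst (chom_scale sM) ((lams n)[i := - del - (\<Sum>k<n. lam k)]) (\<gamma> (swap i n cs)) = - \<gamma> cs \<longleftrightarrow>
    (\<forall>b. lsubst sM (swap i n (lams (Suc n))) (uncurry (Suc n) \<gamma> (swap i n cs @ [b])) =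
      - uncurry (Suc n) \<gamma> (cs @ [b]))"
  proof (rule skew_iff_uncurry)
    show "(lams n)[i := - del - (\<Sum>k<n. lam k)] ! k \<in> lpolys UNIV n" if "k < n" for k
      using that by (cases "k = i") (auto intro!: lpolys_scalar_intros)
    show "dsub (- (\<Sum>k<Suc n. lam k)) ((lams n)[i := - del - (\<Sum>k<n. lam k)] ! k) =
        swap i n (lams (Suc n)) ! k" if "k < n" for k
      using that assms by (cases "k = i") (auto simp: swap_def dsub_simps)
  qed (use assms cs in \<open>simp_all add: sum_list_swap sum_list_lams\<close>)
  then show ?thesis
    by (metis minus_equation_iff)
qed

end

text \<open>For skew-symmetry the pairs match: i < j < n come from \<gamma> as a cochain and the
  pairs (i, n) from the Lie condition, together all pairs below n + 1. The new last slot is covered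
  by \<open>uncurry_last\<close>.\<close>

lemma lie_cochain_iff_uncurry:
  assumes \<gamma>: "curried (Suc n) \<gamma>"
  shows "\<gamma> \<in> lie_cochains sA (chom_scale sM) (CHom sA sM) (Suc n) \<longleftrightarrow>
    uncurry (Suc n) \<gamma> \<in> cochains sA sM UNIV (Suc (Suc n))"
proof -
  define W where "W = uncurry (Suc n) \<gamma>"
  note linear = linear_iff_uncurry[OF \<gamma>, folded W_def]
    and derivation = derivation_iff_uncurry_inner[OF \<gamma>, folded W_def]
      derivation_iff_uncurry_last[OF \<gamma>, folded W_def]
    and skew = skew_iff_uncurry_inner[OF \<gamma>, folded W_def] skew_iff_uncurry_last[OF \<gamma>, folded W_def]
    and last = uncurry_last[OF \<gamma>, folded W_def]
  have upd: "(cs @ [b])[i := x] = cs[i := x] @ [b]" "(cs @ [b]) ! i = cs ! i"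
    "(cs @ [b])[Suc n := x] = cs @ [x]" "(cs @ [b]) ! Suc n = b"
    if "length cs = Suc n" "i < Suc n" for cs :: "'a list" and b i x
    using that by (simp_all add: list_update_append nth_append)
  have "W \<in> cochains sA sM UNIV (Suc (Suc n))" if "\<gamma> \<in> lie_cochains sA (chom_scale sM) (CHom sA sM) (Suc n)"
  proof -
    note * = that[unfolded lie_cochains_def cochains_def mem_Collect_eq diff_Suc_1]
    have c1: "\<forall>cs i. length cs = Suc n \<longrightarrow> i < Suc n \<longrightarrow>
        C_linear sA (chom_scale sM) (\<lambda>x. \<gamma> (cs[i := x]))"
      using * by (elim conjE)
    have c2: "\<forall>cs i. length cs = Suc n \<longrightarrow> i < n \<longrightarrow>
        \<gamma> (cs[i := sA D (cs ! i)]) = lact (chom_scale sM) (- lam i) (\<gamma> cs)"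
      using * by (elim conjE)
    have c3: "\<forall>cs. length cs = Suc n \<longrightarrow>
        \<gamma> (cs[n := sA D (cs ! n)]) = lact (chom_scale sM) (del + (\<Sum>k<n. lam k)) (\<gamma> cs)"
      using * by (elim conjE)
    have c4: "\<forall>cs i j. length cs = Suc n \<longrightarrow> i < j \<longrightarrow> j < n \<longrightarrow>
        lsubst (chom_scale sM) (swap i j (lams n)) (\<gamma> (swap i j cs)) = - \<gamma> cs"
      using * by (elim conjE)
    have c5: "\<forall>cs i. length cs = Suc n \<longrightarrow> i < n \<longrightarrow>
        \<gamma> cs = - lsubst (chom_scale sM) ((lams n)[i := - del - (\<Sum>k<n. lam k)]) (\<gamma> (swap i n cs))"
      using * by (elim conjE)
    show ?thesis
      unfolding cochains_def mem_Collect_eq diff_Suc_1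
    proof (intro conjI allI impI)
      show "W as = 0" if "length as \<noteq> Suc (Suc n)" for as
        using that by (simp add: W_def uncurry_def)
    next
      fix as :: "'a list" and i j assume "length as = Suc (Suc n)"
      then obtain cs b where as: "as = cs @ [b]" and cs: "length cs = Suc n"
        using length_Suc_snoc by blast
      show "W as \<in> lpolys UNIV (Suc n)"
        unfolding as by (rule last(1)[OF cs])
      show "W (as[Suc n := sA D (as ! Suc n)]) = lact sM (del + (\<Sum>k<Suc n. lam k)) (W as)"
        unfolding as upd(3,4)[OF cs lessI] by (rule last(3)[OF cs])
      show "C_linear sA sM (\<lambda>x. W (as[i := x]))" if i: "i < Suc (Suc n)"
      proof (cases "i = Suc n")
        case True
        then show ?thesis using last(2)[OF cs] upd(3)[OF cs lessI] as by simp
      next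
        case False
        with i have i': "i < Suc n" by simp
        with c1 cs have "C_linear sA (chom_scale sM) (\<lambda>x. \<gamma> (cs[i := x]))"
          by blast
        then show ?thesis using linear[OF cs] upd(1)[OF cs i'] as by simp
      qed
      show "W (as[i := sA D (as ! i)]) = lact sM (- lam i) (W as)" if i: "i < Suc n"
        unfolding as upd(1,2)[OF cs i]
        using c2 c3 cs derivation[OF cs] i by (cases "i = n") auto
      show "lsubst sM (swap i j (lams (Suc n))) (W (swap i j as)) = - W as" if ij: "i < j" "j < Suc n"
      proof -
        have swap: "swap i j (cs @ [b]) = swap i j cs @ [b]"
          using ij cs by (simp add: swap_append)
        show ?thesis
        proof (cases "j = n")
          case True
          with ij have "i < n" by simp
          with c5 cs True swap show ?thesis
            unfolding as using skew(2)[OF cs \<open>i < n\<close>] by metis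
        next
          case False
          with ij have "j < n" by simp
          with c4 cs ij swap show ?thesis
            unfolding as using skew(1)[OF cs \<open>i < j\<close> \<open>j < n\<close>] by metis
        qed
      qed
    qed
  qed
  moreover have "\<gamma> \<in> lie_cochains sA (chom_scale sM) (CHom sA sM) (Suc n)" if "W \<in> cochains sA sM UNIV (Suc (Suc n))"
  proof -
    have W: "C_linear sA sM (\<lambda>x. W (cs[i := x] @ [b]))"
      "W (cs[i := sA D (cs ! i)] @ [b]) = lact sM (- lam i) (W (cs @ [b]))"
      if "length cs = Suc n" "i < Suc n" for cs b i
    proof -
      have "length (cs @ [b]) = Suc (Suc n)" "i < Suc (Suc n)" "i < Suc (Suc n) - 1"
        using that by auto
      then have "C_linear sA sM (\<lambda>x. W ((cs @ [b])[i := x]))"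
        "W ((cs @ [b])[i := sA D ((cs @ [b]) ! i)]) = lact sM (- lam i) (W (cs @ [b]))"
        using \<open>W \<in> _\<close> unfolding cochains_def by blast+
      then show "C_linear sA sM (\<lambda>x. W (cs[i := x] @ [b]))"
        "W (cs[i := sA D (cs ! i)] @ [b]) = lact sM (- lam i) (W (cs @ [b]))"
        unfolding upd(1,2)[OF that] .
    qed
    have W_swap: "lsubst sM (swap i j (lams (Suc n))) (W (swap i j cs @ [b])) = - W (cs @ [b])"
      if "length cs = Suc n" "i < j" "j < Suc n" for cs b i j
    proof -
      have "length (cs @ [b]) = Suc (Suc n)" "j < Suc (Suc n) - 1"
        using that by auto
      then have "lsubst sM (swap i j (lams (Suc (Suc n) - 1))) (W (swap i j (cs @ [b]))) = - W (cs @ [b])"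
        using \<open>W \<in> _\<close> \<open>i < j\<close> unfolding cochains_def by blast
      then show ?thesis
        using that by (simp add: swap_append)
    qed
    show ?thesis
      unfolding lie_cochains_def cochains_def mem_Collect_eq diff_Suc_1
    proof (intro conjI allI impI)
      fix as :: "'a list" and i j assume as: "length as = Suc n"
      show "C_linear sA (chom_scale sM) (\<lambda>x. \<gamma> (as[i := x]))" if "i < Suc n"
        using W(1)[OF as that] linear[OF as] by simp
      show "\<gamma> (as[i := sA D (as ! i)]) = lact (chom_scale sM) (- lam i) (\<gamma> as)" if "i < n"
        using W(2)[OF as] derivation(1)[OF as that] that by simp
      show "\<gamma> (as[n := sA D (as ! n)]) = lact (chom_scale sM) (del + (\<Sum>k<n. lam k)) (\<gamma> as)"
        using W(2)[OF as] derivation(2)[OF as] by simp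
      show "lsubst (chom_scale sM) (swap i j (lams n)) (\<gamma> (swap i j as)) = - \<gamma> as" if "i < j" "j < n"
        using W_swap[OF as that(1)] skew(1)[OF as that] that by simp
      show "\<gamma> as = - lsubst (chom_scale sM) ((lams n)[i := - del - (\<Sum>k<n. lam k)]) (\<gamma> (swap i n as))"
        if "i < n"
        using W_swap[OF as that] skew(2)[OF as that] by simp
    qed (use \<gamma> in \<open>auto simp: curried_def\<close>)
  qed
  ultimately show ?thesis
    by (auto simp: W_def)
qed

text \<open>With all but the last argument fixed, \<omega> satisfies the hypotheses of
  \<open>ceval_total_exists\<close>, and a preimage is chosen separately for each list. That it is a
  Lie cochain follows afterwards from \<open>lie_cochain_iff_uncurry\<close>.\<close>

lemma uncurry_surj:
  assumes fg: "finitely_generated sA" and \<omega>: "\<omega> \<in> cochains sA sM UNIV (Suc (Suc n))"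
  shows "\<exists>\<gamma>. curried (Suc n) \<gamma> \<and> uncurry (Suc n) \<gamma> = \<omega>"
proof -
  have len: "\<omega> as = 0" if "length as \<noteq> Suc (Suc n)" for as
    using \<omega> that by (auto simp: cochains_def)
  have ex: "\<exists>F\<in>lpolys (CHom sA sM) n. \<forall>b. ceval sM F (\<Sum>k<Suc n. lam k) (const b) = \<omega> (cs @ [b])"
    if cs: "length cs = Suc n" for cs
  proof (rule ceval_total_exists[OF fg])
    show "\<omega> (cs @ [b]) \<in> lpolys UNIV (Suc n)" for b
      using \<omega> cs by (simp add: cochains_def)
    have upd: "(cs @ [b])[Suc n := x] = cs @ [x]" "(cs @ [b]) ! Suc n = b" for b x
      using cs by (simp_all add: list_update_append nth_append)
    \<comment> \<open>The 0 is a placeholder that the update overwrites.\<close>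
    have "C_linear sA sM (\<lambda>x. \<omega> ((cs @ [0])[Suc n := x]))"
      using \<omega> cs unfolding cochains_def by auto
    then show "C_linear sA sM (\<lambda>b. \<omega> (cs @ [b]))"
      unfolding upd .
    have "\<forall>as. length as = Suc (Suc n) \<longrightarrow> \<omega> (as[Suc (Suc n) - 1 := sA D (as ! (Suc (Suc n) - 1))]) =
        lact sM (del + (\<Sum>k<Suc (Suc n) - 1. lam k)) (\<omega> as)"
      using \<omega> unfolding cochains_def by blast
    then show "\<omega> (cs @ [sA D b]) = lact sM (del + (\<Sum>k<Suc n. lam k)) (\<omega> (cs @ [b]))" for b
      using cs upd by (metis diff_Suc_1 length_append_singleton)
  qed
  define \<gamma> where "\<gamma> cs = (if length cs = Suc n then (SOME F. F \<in> lpolys (CHom sA sM) n \<and>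
    (\<forall>b. ceval sM F (\<Sum>k<Suc n. lam k) (const b) = \<omega> (cs @ [b]))) else 0)" for cs
  have \<gamma>: "\<gamma> cs \<in> lpolys (CHom sA sM) n \<and>
      (\<forall>b. ceval sM (\<gamma> cs) (\<Sum>k<Suc n. lam k) (const b) = \<omega> (cs @ [b]))"
    if "length cs = Suc n" for cs
    using someI_ex[OF ex[OF that, unfolded Bex_def]] that by (simp add: \<gamma>_def)
  have "curried (Suc n) \<gamma>"
    using \<gamma> by (auto simp: curried_def) (simp add: \<gamma>_def)
  moreover have "uncurry (Suc n) \<gamma> = \<omega>"
  proof
    fix as
    show "uncurry (Suc n) \<gamma> as = \<omega> as"
    proof (cases "length as = Suc (Suc n)")
      case True
      then obtain cs b where "as = cs @ [b]" "length cs = Suc n"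
        using length_Suc_snoc by blast
      then show ?thesis
        using \<gamma> by (simp add: uncurry_snoc del: sum.lessThan_Suc)
    qed (simp add: uncurry_def len)
  qed
  ultimately show ?thesis by blast
qed

end

section \<open>Cosets and cohomology under a bijection of complexes\<close>

lemma additive_image_plus:
  assumes "additive f"
  shows "f ` (X + Y) = f ` X + f ` Y"
  by (auto simp: set_plus_def additive.add[OF assms] image_iff) (metis additive.add[OF assms])+

lemma additive_image_coset_scale:
  assumes "additive f" "\<And>x. f (s c x) = t c (f x)"
  shows "f ` coset_scale s c X = coset_scale t c (f ` X)"
proof -
  have "{x - y | x y. x \<in> Z \<and> y \<in> Z} = (\<lambda>(x, y). x - y) ` (Z \<times> Z)" for Z :: "'z::ab_group_add set"
    by auto
  then have "f ` {x - y | x y. x \<in> X \<and> y \<in> X} = {x - y | x y. x \<in> f ` X \<and> y \<in> f ` X}"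
    by (force simp: additive.diff[OF assms(1)] image_image)
  then show ?thesis
    by (simp add: coset_scale_def additive_image_plus[OF assms(1)] image_image assms(2))
qed

text \<open>A bijection of complexes acts on cosets of coboundaries by taking images.\<close>

lemma quotient_isomorphic_cohomology:
  fixes \<Phi> \<Phi>' :: "'c::ab_group_add \<Rightarrow> 'e::ab_group_add"
  assumes add: "additive \<Phi>" and scale: "\<And>c x. \<Phi> (s c x) = t c (\<Phi> x)"
    and inj: "inj_on \<Phi> S" and S: "\<And>x y. x \<in> S \<Longrightarrow> y \<in> S \<Longrightarrow> x + y \<in> S" "C (Suc m) \<subseteq> S" "d m ` C m \<subseteq> S"
    and "\<Phi> ` C (Suc m) = K (Suc (Suc m))" "\<Phi>' ` C m = K (Suc m)"
    and comm: "\<And>x. x \<in> C m \<Longrightarrow> \<Phi> (d m x) = \<delta> (Suc m) (\<Phi>' x)"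
    and closed: "\<And>x. x \<in> C (Suc m) \<Longrightarrow> d (Suc m) x = 0 \<longleftrightarrow> \<delta> (Suc (Suc m)) (\<Phi> x) = 0"
    and m: "0 < m"
  shows "quotient_isomorphic s (cohomology C d (Suc m)) t (cohomology K \<delta> (Suc (Suc m)))"
proof -
  \<comment> \<open>\<open>0 < m\<close> rules out the default \<open>{0}\<close> of
    \<open>coboundaries\<close> in degree 1, so both sides are images of a differential.\<close>
  have bd: "coboundaries C d (Suc m) = d m ` C m"
    "coboundaries K \<delta> (Suc (Suc m)) = \<Phi> ` coboundaries C d (Suc m)"
    using m comm by (auto simp: coboundaries_def image_image simp flip: assms(8))
  have coset: "\<Phi> ` (x +o B) = \<Phi> x +o \<Phi> ` B" for x B
    by (force simp: elt_set_plus_def additive.add[OF add])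
  have cyc: "cocycles K \<delta> (Suc (Suc m)) = \<Phi> ` cocycles C d (Suc m)"
    using closed by (auto simp: cocycles_def simp flip: assms(7))
  have "cohomology K \<delta> (Suc (Suc m)) = (`) \<Phi> ` cohomology C d (Suc m)"
    unfolding cohomology_def bd(2) cyc image_image coset ..
  \<comment> \<open>Elements of a coset are sums of a cocycle and a coboundary, hence in
    \<open>S\<close>. Injectivity of \<Phi> on \<open>S\<close> then separates the images of subsets
    of \<open>S\<close>, in particular of cosets.\<close>
  moreover have "X \<subseteq> S" if "X \<in> cohomology C d (Suc m)" for X
  proof -
    have "x + d m y \<in> S" if "x \<in> C (Suc m)" "y \<in> C m" for x y
      using that S(2,3) by (intro S(1)) auto
    then show ?thesis
      using that by (auto simp: cohomology_def bd(1) cocycles_def elt_set_plus_def)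
  qed
  then have "inj_on ((`) \<Phi>) (cohomology C d (Suc m))"
    by (intro inj_onI) (use inj_on_image_eq_iff[OF inj] in blast)
  ultimately have "bij_betw ((`) \<Phi>) (cohomology C d (Suc m)) (cohomology K \<delta> (Suc (Suc m)))"
    by (simp add: bij_betw_def)
  then show ?thesis
    unfolding quotient_isomorphic_def
    using additive_image_plus[OF add] additive_image_coset_scale[OF add, of s _ t] scale by blast
qed

theorem proposition3p14:
  fixes sA :: "complex poly \<Rightarrow> 'a::ab_group_add \<Rightarrow> 'a"
    and prd :: "'a \<Rightarrow> 'a \<Rightarrow> 'a lpoly"
    and sM :: "complex poly \<Rightarrow> 'm::ab_group_add \<Rightarrow> 'm"
    and lM :: "'a \<Rightarrow> 'm \<Rightarrow> 'm lpoly"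
    and rM :: "'m \<Rightarrow> 'a \<Rightarrow> 'm lpoly"
    and n :: nat
  assumes "left_symmetric_conformal_algebra sA prd"
    and "lsca_module sA prd sM lM rM"
    and "n \<ge> 3"
  shows "quotient_isomorphic
           (cochain_scale (chom_scale sM))
           (H_lie sA (subadjacent sA prd)
              (chom_scale sM) (CHom sA sM) (chom_act sA prd sM lM rM) (n - 1))
           (cochain_scale sM)
           (H_lsca sA prd sM lM rM n)"
proof -
  interpret lsca_module sA prd sM lM rM by fact
  \<comment> \<open>The Lie side then has degree k + 2, and its coboundaries come from degree k + 1,
    where the complex has already begun.\<close>
  obtain k where n: "n = Suc (Suc (Suc k))"
    using assms(3) by (metis Suc_le_D numeral_3_eq_3 Suc_le_mono)
  let ?C = "lie_cochains sA (chom_scale sM) (CHom sA sM)"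
  have curried: "curried m \<gamma>" and vanish: "0 \<in> set as \<Longrightarrow> \<gamma> as = 0" if "\<gamma> \<in> ?C m" for \<gamma> m as
    using that cochain_curried cochain_vanish by (auto simp: lie_cochains_def)
  \<comment> \<open>Surjectivity gives a preimage that is merely \<open>curried\<close>; the
    equivalence of cochain conditions makes it a Lie cochain.\<close>
  have image: "uncurry (Suc i) ` ?C (Suc i) = cochains sA sM UNIV (Suc (Suc i))" for i
    using uncurry_surj[OF A.fg, of _ i] lie_cochain_iff_uncurry[of i] curried[of _ "Suc i"]
    by (fastforce simp: image_iff)
  have "quotient_isomorphic (cochain_scale (chom_scale sM))
      (cohomology ?C (d_lie sA br (chom_scale sM) act) (Suc (Suc k))) (cochain_scale sM)
      (cohomology (cochains sA sM UNIV) (d_lsca sA prd sM lM rM) (Suc (Suc (Suc k))))"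
  proof (rule quotient_isomorphic_cohomology[where \<Phi>' = "uncurry (Suc k)"
        and S = "{\<gamma>. curried (Suc (Suc k)) \<gamma>}"])
    show "inj_on (uncurry (Suc (Suc k))) {\<gamma>. curried (Suc (Suc k)) \<gamma>}"
      by (auto intro!: inj_onI uncurry_inject)
    show "d_lie sA br (chom_scale sM) act (Suc k) ` ?C (Suc k) \<subseteq> {\<gamma>. curried (Suc (Suc k)) \<gamma>}"
      using curried_d curried vanish by blast
    show "uncurry (Suc (Suc k)) (d_lie sA br (chom_scale sM) act (Suc k) \<gamma>) =
        d_lsca sA prd sM lM rM (Suc (Suc k)) (uncurry (Suc k) \<gamma>)" if "\<gamma> \<in> ?C (Suc k)" for \<gamma>
      using uncurry_d[OF curried[OF that] vanish[OF that]] .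
    show "d_lie sA br (chom_scale sM) act (Suc (Suc k)) \<gamma> = 0 \<longleftrightarrow>
        d_lsca sA prd sM lM rM (Suc (Suc (Suc k))) (uncurry (Suc (Suc k)) \<gamma>) = 0"
      if "\<gamma> \<in> ?C (Suc (Suc k))" for \<gamma>
    proof -
      \<comment> \<open>With 0 in the class, injectivity applies to the pair of d\<gamma> and 0, so
        vanishing can be tested after uncurrying.\<close>
      have "curried (Suc (Suc (Suc k))) (0 :: 'a list \<Rightarrow> ('a \<Rightarrow> 'm lpoly) lpoly)"
        by (simp add: curried_def C.lpolys_zero)
      then have "d_lie sA br (chom_scale sM) act (Suc (Suc k)) \<gamma> = 0 \<longleftrightarrow>
          uncurry (Suc (Suc (Suc k))) (d_lie sA br (chom_scale sM) act (Suc (Suc k)) \<gamma>) = 0"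
        using uncurry_inject[OF curried_d[OF curried[OF that] vanish[OF that]]]
          additive.zero[OF uncurry_additive] by metis
      then show ?thesis
        by (simp only: uncurry_d[OF curried[OF that] vanish[OF that]])
    qed
  qed (use image curried curried_add uncurry_additive uncurry_scale in auto)
  then show ?thesis
    by (simp add: H_lie_def H_lsca_def n)
qed

end
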